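(* Let $k$ be a non-negative integer. (i) Let $C$ be an $s$-extremal singly even self-dual $[24k+8,12k+4,4k+2]$ code. Let $C_0$ be its subcode of codewords of weight $\equiv 0 \pmod 4$, and write $C_0^\perp=C_0\cup C_1\cup C_2\cup C_3$ as a disjoint union of cosets of $C_0$, where $C=C_0\cup C_2$ and $S=C_1\cup C_3$ is the shadow of $C$. Then the two doubly even self-dual neighbors $C_0\cup C_1$ and $C_0\cup C_3$ of $C$ are extremal (i.e. have minimum weight $4k+4$), and their covering radii are $4k+2$, meeting the Delsarte bound. (ii) Conversely, if $D$ is an extremal doubly even self-dual $[24k+8,12k+4,4k+4]$ code with covering radius $4k+2$, then $D$ has a neighbor which is an $s$-extremal singly even self-dual $[24k+8,12k+4,4k+2]$ code.
   Context: All codes are binary: an $[n,m]$ code is an $m$-dimensional subspace $C$ of $\mathbb{F}_2^n$, and it is an $[n,m,d]$ code if its minimum non-zero weight $d(C)$ is $d$. The dual is $C^\perp=\{x\in\mathbb{F}_2^n \mid x\cdot y=0 \text{ for all } y\in C\}$ for the standard inner product, and $C$ is self-dual if $C=C^\perp$. A self-dual code is doubly even if all its weights are $\equiv 0\pmod 4$, and singly even if some codeword has weight $\equiv 2\pmod 4$. A self-dual code of length $n$ satisfies $d(C)\le 4\lfloor n/24\rfloor+4$ unless $n\equiv 22\pmod{24}$, in which case $d(C)\le 4\lfloor n/24\rfloor+6$; it is extremal if it meets this bound. For a singly even self-dual code $C$, let $C_0$ be the subcode (of codimension 1) of codewords of weight $\equiv 0\pmod 4$; the shadow of $C$ is $S=C_0^\perp\setminus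 C$. The minimum weight $d(\cdot)$ of a coset, or of the shadow, is the minimum non-zero weight of the vectors in it. A singly even self-dual code $C$ of length $n$ satisfies $d(S)\le \frac n2+4-2d(C)$ unless $n\equiv 22\pmod{24}$ and $d(C)=4\lfloor n/24\rfloor+6$; outside this exceptional case, $C$ is called $s$-extremal if $d(S)=\frac n2+4-2d(C)$. Two self-dual codes $C,C'$ of length $n$ are neighbors if $\dim(C\cap C')=n/2-1$. If $C$ is a singly even self-dual code of length divisible by 8, it has exactly two doubly even self-dual neighbors of the form $C_0\cup C_1$ and $C_0\cup C_3$, where $C_1,C_2,C_3$ are the cosets of $C_0$ such that $C_0^\perp=C_0\cup C_1\cup C_2\cup C_3$ is a disjoint union with $C=C_0\cup C_2$ and $S=C_1\cup C_3$. The covering radius $R(C)$ is the smallest integer $R$ such that the Hamming spheres of radius $R$ around the codewords of $C$ cover $\mathbb{F}_2^n$. The Delsarte bound states $R(C)\le|\{i\mid A_i^\perp\neq 0,\ 0<i\le n\}|$, where $A_i^\perp$ is the number of vectors of weight $i$ in $C^\perp$. *)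

theory Defs
  imports "HOL-Analysis.Analysis" "HOL-Library.Z2"
begin

text \<open>
  The ambient space $F_2^n$ is the type \<^typ>\<open>bit ^ 'n\<close>, with $n$ the cardinality of the
  index type \<^typ>\<open>'n\<close>.
\<close>

definition weight :: "bit ^ 'n \<Rightarrow> nat" where
  "weight x = card {i. x $ i \<noteq> 0}"

definition hamming_dist :: "bit ^ 'n \<Rightarrow> bit ^ 'n \<Rightarrow> nat" where
  "hamming_dist x y = card {i. x $ i \<noteq> y $ i}"

text \<open>
  Used for codes, cosets and shadows alike. Without non-zero vectors the value is 0, as
  \<open>Inf {} = 0\<close> on \<^typ>\<open>nat\<close>.
\<close>

definition min_weight :: "(bit ^ 'n) set \<Rightarrow> nat" where
  "min_weight A = Inf (weight ` (A - {0}))"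

definition is_code :: "nat \<Rightarrow> nat \<Rightarrow> nat \<Rightarrow> (bit ^ 'n) set \<Rightarrow> bool" where
  "is_code n m d C \<longleftrightarrow>
     CARD('n) = n \<and> vec.subspace C \<and> vec.dim C = m \<and> min_weight C = d"

definition dual :: "(bit ^ 'n) set \<Rightarrow> (bit ^ 'n) set" where
  "dual C = {x. \<forall>y\<in>C. scalar_product x y = 0}"

definition self_dual :: "(bit ^ 'n) set \<Rightarrow> bool" where
  "self_dual C \<longleftrightarrow> vec.subspace C \<and> dual C = C"

definition doubly_even_self_dual :: "(bit ^ 'n) set \<Rightarrow> bool" where
  "doubly_even_self_dual C \<longleftrightarrow> self_dual C \<and> (\<forall>x\<in>C. weight x mod 4 = 0)"

definition singly_even_self_dual :: "(bit ^ 'n) set \<Rightarrow> bool" where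
  "singly_even_self_dual C \<longleftrightarrow> self_dual C \<and> (\<exists>x\<in>C. weight x mod 4 = 2)"

definition extremal :: "(bit ^ 'n) set \<Rightarrow> bool" where
  "extremal C \<longleftrightarrow> self_dual C \<and>
     min_weight C = (if CARD('n) mod 24 = 22 then 4 * (CARD('n) div 24) + 6
                     else 4 * (CARD('n) div 24) + 4)"

definition doubly_even_subcode :: "(bit ^ 'n) set \<Rightarrow> (bit ^ 'n) set" where
  "doubly_even_subcode C = {x \<in> C. weight x mod 4 = 0}"

definition shadow :: "(bit ^ 'n) set \<Rightarrow> (bit ^ 'n) set" where
  "shadow C = dual (doubly_even_subcode C) - C"

definition s_extremal :: "(bit ^ 'n) set \<Rightarrow> bool" where
  "s_extremal C \<longleftrightarrow> singly_even_self_dual C \<and>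
     \<not> (CARD('n) mod 24 = 22 \<and> min_weight C = 4 * (CARD('n) div 24) + 6) \<and>
     real (min_weight (shadow C)) = real CARD('n) / 2 + 4 - 2 * real (min_weight C)"

definition is_coset :: "(bit ^ 'n) set \<Rightarrow> (bit ^ 'n) set \<Rightarrow> bool" where
  "is_coset U A \<longleftrightarrow> (\<exists>v. A = (+) v ` U)"

text \<open>
  The labels of the two cosets forming the shadow are interchangeable, so the decomposition
  is a relation rather than a function of the code.
\<close>

definition coset_decomposition ::
  "(bit ^ 'n) set \<Rightarrow> (bit ^ 'n) set \<Rightarrow> (bit ^ 'n) set \<Rightarrow> (bit ^ 'n) set \<Rightarrow> (bit ^ 'n) set \<Rightarrow> bool"
where
  "coset_decomposition C C0 C1 C2 C3 \<longleftrightarrow>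
     C0 = doubly_even_subcode C \<and>
     is_coset C0 C1 \<and> is_coset C0 C2 \<and> is_coset C0 C3 \<and>
     dual C0 = C0 \<union> C1 \<union> C2 \<union> C3 \<and>
     C0 \<inter> C1 = {} \<and> C0 \<inter> C2 = {} \<and> C0 \<inter> C3 = {} \<and>
     C1 \<inter> C2 = {} \<and> C1 \<inter> C3 = {} \<and> C2 \<inter> C3 = {} \<and>
     C = C0 \<union> C2 \<and> shadow C = C1 \<union> C3"

definition neighbors :: "(bit ^ 'n) set \<Rightarrow> (bit ^ 'n) set \<Rightarrow> bool" where
  "neighbors C C' \<longleftrightarrow> self_dual C \<and> self_dual C' \<and>
     real (vec.dim (C \<inter> C')) = real CARD('n) / 2 - 1"

definition covering_radius :: "(bit ^ 'n) set \<Rightarrow> nat" where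
  "covering_radius C = (LEAST R. (\<Union>c\<in>C. {x. hamming_dist x c \<le> R}) = UNIV)"

definition weight_count :: "(bit ^ 'n) set \<Rightarrow> nat \<Rightarrow> nat" where
  "weight_count C i = card {x \<in> C. weight x = i}"

definition delsarte_bound :: "(bit ^ 'n) set \<Rightarrow> nat" where
  "delsarte_bound C = card {i. 0 < i \<and> i \<le> CARD('n) \<and> weight_count (dual C) i \<noteq> 0}"

text \<open>
  Finiteness of the ambient space, without which \<^const>\<open>weight_count\<close> could be 0
  for an infinite set of vectors.
\<close>

instance bit :: finite
proof
  have "(UNIV :: bit set) = {0, 1}"
    using bit_not_zero_iff by blast
  then show "finite (UNIV :: bit set)"
    by (metis finite.emptyI finite.insertI)
qed

end

theory Submission
  imports Defs
begin

text \<open>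
  Write \<open>n = 24 k + 8\<close>. Both halves of the correspondence turn on one observation about a doubly
  even self-dual code \<open>D\<close> of length \<open>n\<close> whose non-zero weights are at least \<open>4 k + 4\<close>. The
  all-one vector lies in \<open>D\<close>, so the weights other than \<open>0\<close> and \<open>n\<close> lie among the \<open>4 k + 1\<close>
  multiples of 4 between \<open>4 k + 4\<close> and \<open>20 k + 4\<close>, and the Delsarte bound of \<open>D\<close> is at most
  \<open>4 k + 2\<close>. If some coset of \<open>D\<close> has minimum weight at least \<open>4 k + 2\<close>, then
  \<open>4 k + 2 \<le> R(D) \<le> 4 k + 2\<close>, so the bound is met; moreover none of the possible weights
  can be missing. In particular weight \<open>4 k + 4\<close> occurs, so that \<open>D\<close> is extremal
  (\<open>extremal_of_deep_coset\<close>).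

  For an \<open>s\<close>-extremal code \<open>C\<close> with minimum weight \<open>4 k + 2\<close>, the definition makes
  \<open>4 k + 4\<close> the minimum weight of the shadow. The unions of \<open>C\<^sub>0\<close> with one of the two shadow
  cosets therefore have no non-zero weight below \<open>4 k + 4\<close>, and a minimum weight word of \<open>C\<close>
  leads a coset of minimum weight \<open>4 k + 2\<close>. That these unions are doubly even, and that they are
  the only doubly even neighbors, follows from the fact that shadow vectors have weight divisible
  by 4 when 8 divides the length (\<open>shadow_weight_mod_4\<close>), which is read off from the Gauss sum
  \<open>\<Sum>\<^sub>x \<i>\<^bsup>wt x\<^esup> = (1 + \<i>)\<^bsup>n\<^esup>\<close>.

  Conversely, if \<open>R(D) = 4 k + 2\<close>, take a vector \<open>v\<close> of weight \<open>4 k + 2\<close> that is of minimum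
  weight in \<open>v + D\<close>, put \<open>D\<^sub>0 = {d \<in> D. v \<cdot> d = 0}\<close> and
  \<open>C = D\<^sub>0 \<union> (v + D\<^sub>0)\<close>. Weights modulo 4 show that \<open>C\<close> is singly even with
  doubly even subcode \<open>D\<^sub>0\<close>, and that its shadow, which consists of \<open>D - D\<^sub>0\<close> and
  \<open>v + (D - D\<^sub>0)\<close>, has minimum weight at least \<open>4 k + 4\<close>. Equality needs a vector of
  weight \<open>4 k + 4\<close> in the coset \<open>v + D\<close>. This is the quantitative part of the proof: if
  \<open>B\<^sub>i\<close> counts the vectors of weight \<open>i\<close> in \<open>v + D\<close>, then
  \<open>(4 k + 3) (4 k + 4) B\<^bsub>4k+4\<^esub> = 8 (4 k + 1) (11 k + 3) B\<^bsub>4k+2\<^esub>\<close>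
  (\<open>deep_coset_weight_ratio\<close>), and \<open>B\<^bsub>4k+2\<^esub>\<close> is positive.

  The Delsarte bound and this ratio come from the same computation: sums over \<open>D\<close> of
  \<open>(-1)\<^bsup>v \<cdot> y\<^esup> f(n - 2 wt y)\<close> for polynomials \<open>f\<close> are expressed
  through the numbers of coset vectors of weight at most the degree of \<open>f\<close>, by means of the three-term
  recurrence of the Krawtchouk polynomials (\<open>char_moment_mult\<close>).
\<close>

section \<open>Binary vectors and subspaces\<close>

lemma vector_add_self [simp]: "x + x = (0 :: bit ^ 'n)"
  by (simp add: vec_eq_iff)

lemma vector_add_self_left [simp]: "x + (x + y) = (y :: bit ^ 'n)"
  by (simp only: add.assoc[symmetric] vector_add_self add_0_left)

lemma vector_add_self_right [simp]: "y + x + x = (y :: bit ^ 'n)"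
  by (simp only: add.assoc vector_add_self add_0_right)

lemma vector_add_eq_0_iff: "x + y = 0 \<longleftrightarrow> x = (y :: bit ^ 'n)"
  by (metis add_left_cancel vector_add_self)

lemma vector_diff_eq_add: "x - y = x + (y :: bit ^ 'n)"
  by (simp add: vec_eq_iff)

lemma weight_add:
  fixes x y :: "bit ^ 'n"
  shows "weight (x + y) + 2 * card {i. x $ i \<noteq> 0 \<and> y $ i \<noteq> 0} = weight x + weight y"
proof -
  let ?X = "{i. x $ i \<noteq> 0}" and ?Y = "{i. y $ i \<noteq> 0}"
  have s: "{i. (x + y) $ i \<noteq> 0} = (?X - ?Y) \<union> (?Y - ?X)"
    by auto
  have "card ((?X - ?Y) \<union> (?Y - ?X)) = card (?X - ?Y) + card (?Y - ?X)"
    by (rule card_Un_disjoint) auto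
  moreover have "card ?X = card (?X \<inter> ?Y) + card (?X - ?Y)"
    by (rule card_Int_Diff) simp
  moreover have "card ?Y = card (?Y \<inter> ?X) + card (?Y - ?X)"
    by (rule card_Int_Diff) simp
  moreover have "?Y \<inter> ?X = ?X \<inter> ?Y"
    by blast
  moreover have "?X \<inter> ?Y = {i. x $ i \<noteq> 0 \<and> y $ i \<noteq> 0}"
    by auto
  ultimately show ?thesis
    unfolding weight_def s by simp
qed

lemma scalar_product_eq_0_iff:
  "scalar_product x (y :: bit ^ 'n) = 0 \<longleftrightarrow> even (card {i. x $ i \<noteq> 0 \<and> y $ i \<noteq> 0})"
proof -
  have "scalar_product x y = (\<Sum>i\<in>UNIV. if x $ i \<noteq> 0 \<and> y $ i \<noteq> 0 then 1 else 0)"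
    unfolding scalar_product_def by (intro sum.cong) auto
  also have "\<dots> = of_nat (card {i. x $ i \<noteq> 0 \<and> y $ i \<noteq> 0})"
    by (subst sum.If_cases) simp_all
  finally show ?thesis
    by (metis even_of_nat odd_one bit_not_zero_iff dvd_0_right)
qed

lemma scalar_product_commute: "scalar_product x y = scalar_product y (x :: bit ^ 'n)"
  unfolding scalar_product_def by (intro sum.cong refl mult.commute)

lemma scalar_product_add_left:
  "scalar_product (x + y) z = scalar_product x z + scalar_product y (z :: bit ^ 'n)"
  by (simp only: scalar_product_def vector_add_component distrib_right sum.distrib)

lemma scalar_product_add_right:
  "scalar_product z (x + y) = scalar_product z x + scalar_product z (y :: bit ^ 'n)"
  by (simp only: scalar_product_def vector_add_component distrib_left sum.distrib)

lemma scalar_product_zero [simp]: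
  "scalar_product 0 (x :: bit ^ 'n) = 0" "scalar_product x 0 = 0"
  by (simp_all add: scalar_product_def)

lemma scalar_product_self_eq_0_iff: "scalar_product x (x :: bit ^ 'n) = 0 \<longleftrightarrow> even (weight x)"
  by (simp add: scalar_product_eq_0_iff weight_def del: bit_not_zero_iff)

lemma weight_eq_0_iff [simp]: "weight x = 0 \<longleftrightarrow> x = (0 :: bit ^ 'n)"
proof -
  have "weight x = 0 \<longleftrightarrow> {i. x $ i \<noteq> 0} = {}"
    unfolding weight_def by (rule card_0_eq) simp
  also have "\<dots> \<longleftrightarrow> x = 0"
    by (auto simp: vec_eq_iff)
  finally show ?thesis .
qed

lemma weight_zero [simp]: "weight 0 = 0"
  by simp

lemma weight_one [simp]: "weight (1 :: bit ^ 'n) = CARD('n)"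
  by (simp add: weight_def)

lemma weight_complement: "weight (1 + x) + weight x = CARD('n)" for x :: "bit ^ 'n"
  using weight_add[of 1 x] by (simp add: weight_def)

lemma scalar_product_one_eq_0_iff: "scalar_product 1 x = 0 \<longleftrightarrow> even (weight (x :: bit ^ 'n))"
  by (simp add: scalar_product_eq_0_iff weight_def)

lemma hamming_dist_eq_weight: "hamming_dist x y = weight (x + y)"
proof -
  have "x $ i \<noteq> y $ i \<longleftrightarrow> (x + y) $ i \<noteq> 0" for i
    by (cases "x $ i"; cases "y $ i") auto
  then show ?thesis
    unfolding hamming_dist_def weight_def by presburger
qed

lemma subspace_bit_iff:
  "vec.subspace A \<longleftrightarrow> 0 \<in> A \<and> (\<forall>x\<in>A. \<forall>y\<in>A. x + y \<in> A)" for A :: "(bit ^ 'n) set"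
proof -
  have "c *s x \<in> A" if "0 \<in> A" "x \<in> A" for c and x :: "bit ^ 'n"
    using that by (cases c) auto
  then show ?thesis
    unfolding vec.subspace_def by blast
qed

lemma subspace_add_mem_iff:
  fixes x y :: "bit ^ 'n"
  assumes "vec.subspace A" "y \<in> A"
  shows "x + y \<in> A \<longleftrightarrow> x \<in> A"
proof
  assume "x + y \<in> A"
  then have "(x + y) + y \<in> A"
    using assms by (simp only: subspace_bit_iff)
  then show "x \<in> A" by (simp add: add.assoc)
qed (use assms in \<open>simp add: subspace_bit_iff\<close>)

lemma mem_translate_iff: "x \<in> (+) v ` A \<longleftrightarrow> v + x \<in> A" for x v :: "bit ^ 'n"
proof
  assume "v + x \<in> A"
  then have "v + (v + x) \<in> (+) v ` A" by (rule imageI)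
  then show "x \<in> (+) v ` A" by simp
qed auto

lemma card_translate: "card ((+) v ` A) = card A" for v :: "bit ^ 'n"
  by (simp add: card_image)

text \<open>
  Over the two-element field each new basis vector \<open>b\<close> adjoins to the span exactly one further
  coset, its translate by \<open>b\<close>, which is disjoint from it by independence. So cardinalities can
  stand in for dimensions, and index 2 for codimension 1.
\<close>

lemma card_span_independent:
  fixes B :: "(bit ^ 'n) set"
  assumes "vec.independent B"
  shows "card (vec.span B) = 2 ^ card B"
  using finite[of B] assms
proof (induction B rule: finite_induct)
  case empty
  then show ?case by simp
next
  case (insert b B)
  have ind: "vec.independent B" and b: "b \<notin> vec.span B"
    using insert.prems insert.hyps by (auto simp: vec.independent_insert)
  have sub: "vec.subspace (vec.span B)" by simp
  have eq: "vec.span (insert b B) = vec.span B \<union> (+) b ` vec.span B"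
  proof (intro set_eqI iffI)
    fix x assume "x \<in> vec.span (insert b B)"
    then obtain c where c: "x - c *s b \<in> vec.span B"
      by (auto simp: vec.span_insert)
    have "x \<in> vec.span B \<or> b + x \<in> vec.span B"
      using c by (cases c) (auto simp: vector_diff_eq_add add.commute)
    then show "x \<in> vec.span B \<union> (+) b ` vec.span B"
      by (simp add: mem_translate_iff)
  next
    fix x assume "x \<in> vec.span B \<union> (+) b ` vec.span B"
    then show "x \<in> vec.span (insert b B)"
      by (auto intro: vec.span_add vec.span_base subsetD[OF vec.span_mono[OF subset_insertI]])
  qed
  have "vec.span B \<inter> (+) b ` vec.span B = {}"
    using b subspace_add_mem_iff[OF sub] by (auto simp: mem_translate_iff)
  then have "card (vec.span (insert b B)) = 2 * card (vec.span B)"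
    by (simp add: eq card_Un_disjoint card_translate)
  then show ?case
    using insert ind by simp
qed

lemma card_subspace:
  fixes A :: "(bit ^ 'n) set"
  assumes "vec.subspace A"
  shows "card A = 2 ^ vec.dim A"
proof -
  obtain B where "B \<subseteq> A" "vec.independent B" "A \<subseteq> vec.span B" "card B = vec.dim A"
    using vec.basis_exists[of A] by blast
  moreover from this have "vec.span B = A"
    using assms vec.span_minimal by blast
  ultimately show ?thesis
    using card_span_independent by metis
qed

lemma card_vectors: "CARD(bit ^ 'n) = 2 ^ CARD('n)"
proof -
  have "card (UNIV :: bit set) = 2"
    by (metis UNIV_bool UNIV_def card_UNIV_bool type_definition.card type_definition_bit)
  then show ?thesis by simp
qed

lemma min_weight_attained:
  assumes "A - {0} \<noteq> {}"
  obtains x where "x \<in> A" "x \<noteq> 0" "weight x = min_weight A"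
proof -
  have "Inf (weight ` (A - {0})) \<in> weight ` (A - {0})"
    using assms by (intro Inf_nat_def1) blast
  then show ?thesis
    using that unfolding min_weight_def by force
qed

lemma min_weight_le: "x \<in> A \<Longrightarrow> x \<noteq> 0 \<Longrightarrow> min_weight A \<le> weight x"
  unfolding min_weight_def by (rule cInf_lower) auto

lemma min_weight_eqI:
  assumes "x \<in> A" "x \<noteq> 0" "weight x = d" "\<And>y. y \<in> A \<Longrightarrow> y \<noteq> 0 \<Longrightarrow> d \<le> weight y"
  shows "min_weight A = d"
  using assms by (metis Diff_iff empty_iff le_antisym min_weight_attained min_weight_le singletonD)

section \<open>Characters and duality\<close>

definition chi :: "bit ^ 'n \<Rightarrow> bit ^ 'n \<Rightarrow> real" where
  "chi x y = (if scalar_product x y = 0 then 1 else - 1)"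

lemma chi_commute: "chi x y = chi y x"
  by (simp add: chi_def scalar_product_commute)

lemma chi_add: "chi (x + y) z = chi x z * chi y z"
  by (cases "scalar_product x z"; cases "scalar_product y z")
    (auto simp: chi_def scalar_product_add_left)

lemma chi_zero [simp]: "chi 0 y = 1" "chi x 0 = 1"
  by (simp_all add: chi_def)

lemma subspace_dual: "vec.subspace (dual A)"
  by (auto simp: subspace_bit_iff dual_def scalar_product_add_left)

lemma subset_dual_dual: "A \<subseteq> dual (dual A)"
  by (auto simp: dual_def scalar_product_commute)

lemma dual_antimono: "A \<subseteq> B \<Longrightarrow> dual B \<subseteq> dual A"
  by (auto simp: dual_def)

text \<open>
  Orthogonality of characters: a word \<open>u \<in> U\<close> with \<open>x \<cdot> u = 1\<close> pairs \<open>y\<close> with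
  \<open>u + y\<close>, at which the character takes the opposite value.
\<close>

lemma sum_chi_subspace:
  assumes U: "vec.subspace U"
  shows "(\<Sum>y\<in>U. chi x y) = (if x \<in> dual U then real (card U) else 0)"
proof (cases "x \<in> dual U")
  case True
  then show ?thesis by (simp add: dual_def chi_def)
next
  case False
  then obtain u where u: "u \<in> U" "scalar_product x u \<noteq> 0"
    by (auto simp: dual_def)
  have "(\<Sum>y\<in>U. chi x y) = (\<Sum>y\<in>U. chi x (u + y))"
    by (rule sum.reindex_bij_witness[where i = "(+) u" and j = "(+) u"])
      (use U u in \<open>auto simp: subspace_bit_iff\<close>)
  also have "\<dots> = (\<Sum>y\<in>U. - chi x y)"
    using u by (intro sum.cong) (auto simp: chi_commute[of x] chi_add, auto simp: chi_def scalar_product_commute)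
  finally show ?thesis
    using False by (simp add: sum_negf)
qed

text \<open>
  Both sides count the double sum of \<open>chi x y\<close> over all \<open>x\<close> and all \<open>y \<in> U\<close>: summing over
  \<open>y\<close> first leaves the dual, summing over \<open>x\<close> first leaves \<open>y = 0\<close>.
\<close>

lemma card_dual:
  fixes U :: "(bit ^ 'n) set"
  assumes U: "vec.subspace U"
  shows "card (dual U) * card U = 2 ^ CARD('n)"
proof -
  have "dual UNIV = {0 :: bit ^ 'n}"
  proof -
    have "x = 0" if "\<forall>y. scalar_product x y = 0" for x :: "bit ^ 'n"
    proof -
      have "x $ i = 0" for i
      proof (rule ccontr)
        assume "x $ i \<noteq> 0"
        then have "{j. x $ j \<noteq> 0 \<and> axis i 1 $ j \<noteq> (0 :: bit)} = {i}"
          by (auto simp: axis_def)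
        then show False
          using that[rule_format, of "axis i 1"] by (simp only: scalar_product_eq_0_iff) simp
      qed
      then show ?thesis by (simp add: vec_eq_iff)
    qed
    then show ?thesis by (auto simp: dual_def)
  qed
  then have all: "(\<Sum>x\<in>UNIV. chi x y) = (if y = 0 then 2 ^ CARD('n) else 0)" for y :: "bit ^ 'n"
    using sum_chi_subspace[of UNIV y]
    by (simp only: chi_commute[of y] card_vectors \<open>dual UNIV = {0}\<close>) simp
  have "real (card (dual U) * card U) = (\<Sum>x\<in>UNIV. \<Sum>y\<in>U. chi x y)"
    by (simp add: sum_chi_subspace[OF U] sum.If_cases)
  also have "\<dots> = (\<Sum>y\<in>U. \<Sum>x\<in>UNIV. chi x y)"
    by (rule sum.swap)
  also have "\<dots> = 2 ^ CARD('n)"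
    using U by (simp add: all sum.If_cases subspace_bit_iff)
  finally have "real (card (dual U) * card U) = real (2 ^ CARD('n))" by simp
  then show ?thesis by (simp only: of_nat_eq_iff)
qed

lemma dual_dual:
  assumes "vec.subspace U"
  shows "dual (dual U) = U"
proof -
  have "card (dual U) * card U = card (dual (dual U)) * card (dual U)"
    using card_dual[OF assms] card_dual[OF subspace_dual[of U]] by simp
  moreover have "card (dual U) \<noteq> 0"
    using subspace_dual[of U] by (auto simp: subspace_bit_iff)
  ultimately have "card U = card (dual (dual U))"
    by (metis mult.commute mult_left_cancel)
  then show ?thesis
    using card_subset_eq[OF _ subset_dual_dual[of U]] by simp
qed

lemma self_dual_card:
  fixes C :: "(bit ^ 'n) set"
  assumes "self_dual C"
  shows "card C * card C = 2 ^ CARD('n)"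
  using card_dual[of C] assms by (simp add: self_dual_def)

lemma self_dualI:
  fixes C :: "(bit ^ 'n) set"
  assumes "vec.subspace C" "C \<subseteq> dual C" "card C * card C = 2 ^ CARD('n)"
  shows "self_dual C"
proof -
  have "card (dual C) * card C = card C * card C" "card C \<noteq> 0"
    using assms card_dual[OF assms(1)] by (auto simp: subspace_bit_iff)
  then have "card C = card (dual C)"
    by (metis mult_right_cancel)
  then have "C = dual C"
    using card_subset_eq[OF _ assms(2)] by simp
  then show ?thesis
    using assms(1) by (simp add: self_dual_def)
qed

lemma self_dual_subset_eq:
  assumes "self_dual C" "self_dual D" "C \<subseteq> D"
  shows "C = D"
  using assms dual_antimono[of C D] by (auto simp: self_dual_def)

text \<open>
  The character of \<open>w\<close> is non-trivial on \<open>U\<close>, so it takes its two values equally often.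
\<close>

lemma card_orthogonal_half:
  assumes U: "vec.subspace U" and w: "w \<notin> dual U"
  shows "2 * card {u \<in> U. scalar_product w u = 0} = card U"
proof -
  have "(\<Sum>u\<in>U. chi w u) = 0"
    using sum_chi_subspace[OF U] w by simp
  then have "real (card {u \<in> U. scalar_product w u = 0}) = real (card {u \<in> U. scalar_product w u \<noteq> 0})"
    by (simp add: chi_def sum.If_cases Int_def del: bit_not_zero_iff)
  then have "card {u \<in> U. scalar_product w u = 0} = card {u \<in> U. scalar_product w u \<noteq> 0}"
    by (simp only: of_nat_eq_iff)
  moreover have "card U = card {u \<in> U. scalar_product w u = 0} + card {u \<in> U. scalar_product w u \<noteq> 0}"
    by (subst card_Un_disjoint[symmetric]) (auto intro!: arg_cong[of _ _ card])
  ultimately show ?thesis by simp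
qed

text \<open>
  By \<open>weight_add\<close>, twice the overlap of two words is a combination of their weights and that of
  their sum, hence divisible by 4; so the overlap is even.
\<close>

lemma doubly_even_subspace_self_orthogonal:
  assumes U: "vec.subspace U" and de: "\<forall>x\<in>U. weight x mod 4 = 0"
  shows "U \<subseteq> dual U"
proof -
  have "scalar_product x y = 0" if "x \<in> U" "y \<in> U" for x y
  proof -
    have "weight (x + y) mod 4 = 0" "weight x mod 4 = 0" "weight y mod 4 = 0"
      using that U de by (auto simp: subspace_bit_iff)
    then show ?thesis
      using weight_add[of x y] unfolding scalar_product_eq_0_iff by presburger
  qed
  then show ?thesis by (auto simp: dual_def)
qed

section \<open>Moments of character sums and the Delsarte bound\<close>

text \<open>
  The first Krawtchouk polynomial, evaluated at the weight. It is an affine function of the weight,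
  so the polynomials in it are exactly the polynomials in the weight, and it is the sum of the
  characters of the unit vectors (\<open>sum_chi_axis\<close>).
\<close>

definition krawtchouk_one :: "bit ^ 'n \<Rightarrow> real" where
  "krawtchouk_one y = real CARD('n) - 2 * real (weight y)"

text \<open>
  For a subspace \<open>D\<close> and \<open>f = (\<lambda>_. 1)\<close> this counts, up to the factor \<open>card D\<close>, the vectors of weight \<open>i\<close> in the
  coset \<open>v + dual D\<close> (\<open>char_moment_const\<close>); for \<open>i = 0\<close> it is a character sum over \<open>D\<close> weighted by
  \<open>f\<close> (\<open>char_moment_0\<close>). The other values interpolate between the two.
\<close>

definition char_moment :: "bit ^ 'n \<Rightarrow> (bit ^ 'n) set \<Rightarrow> nat \<Rightarrow> (bit ^ 'n \<Rightarrow> real) \<Rightarrow> real" where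
  "char_moment v D i f = (\<Sum>x | weight x = i. \<Sum>y\<in>D. chi (v + x) y * f y)"

lemma support_axis: "{j. x $ j \<noteq> 0 \<and> axis i 1 $ j \<noteq> (0 :: bit)} = (if x $ i = 0 then {} else {i})"
  by (auto simp: axis_def)

lemma weight_axis: "weight (axis i 1 :: bit ^ 'n) = 1"
proof -
  have "{j. axis i 1 $ j \<noteq> (0 :: bit)} = {i}"
    by (auto simp: axis_def)
  then show ?thesis
    by (simp only: weight_def) simp
qed

lemma weight_add_axis:
  "weight (x + axis i 1) = (if x $ i = 0 then weight x + 1 else weight x - 1)" for x :: "bit ^ 'n"
proof -
  have "weight (x + axis i 1) + 2 * (if x $ i = 0 then 0 else 1) = weight x + 1"
    using weight_add[of x "axis i 1"] unfolding support_axis weight_axis by (simp split: if_splits)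
  then show ?thesis by (simp split: if_splits)
qed

lemma sum_chi_axis: "(\<Sum>i\<in>UNIV. chi (axis i 1) y) = krawtchouk_one y" for y :: "bit ^ 'n"
proof -
  have "chi (axis i 1) y = (if y $ i \<noteq> 0 then - 1 else 1)" for i
    unfolding chi_def scalar_product_commute[of _ y] scalar_product_eq_0_iff support_axis by simp
  then have "(\<Sum>i\<in>UNIV. chi (axis i 1) y) = (\<Sum>i\<in>UNIV. 1 - 2 * (if y $ i \<noteq> 0 then 1 else 0))"
    by (intro sum.cong) auto
  also have "\<dots> = krawtchouk_one y"
    unfolding sum_subtractf sum_distrib_left[symmetric] krawtchouk_one_def weight_def
    by (subst sum.If_cases) simp_all
  finally show ?thesis .
qed

text \<open>
  Flipping a coordinate inside the support lowers the weight by one, outside it raises it by one.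
\<close>

lemma card_flips_of_weight:
  "card {j. weight (x + axis j 1) = i} =
     (if weight x = i + 1 then i + 1 else if weight x + 1 = i then CARD('n) + 1 - i else 0)"
  for x :: "bit ^ 'n"
proof -
  have pos: "weight x > 0" if "x $ j \<noteq> 0" for j
    using that by (metis weight_eq_0_iff gr0I zero_index)
  have co: "card {j. x $ j = 0} = CARD('n) - weight x"
  proof -
    have "{j. x $ j = 0} = - {j. x $ j \<noteq> 0}" by auto
    then show ?thesis by (simp only: Compl_eq_Diff_UNIV card_Diff_subset weight_def finite subset_UNIV)
  qed
  consider "weight x = i + 1" | "weight x + 1 = i" | "weight x \<noteq> i + 1" "weight x + 1 \<noteq> i" by blast
  then show ?thesis
  proof cases
    case 1
    then have "{j. weight (x + axis j 1) = i} = {j. x $ j \<noteq> 0}"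
      by (auto simp: weight_add_axis)
    then show ?thesis using 1 by (simp add: weight_def)
  next
    case 2
    then have "{j. weight (x + axis j 1) = i} = {j. x $ j = 0}"
      by (auto simp: weight_add_axis)
    then show ?thesis using 2 co by simp
  next
    case 3
    have "{j. weight (x + axis j 1) = i} = {}"
      using 3 pos by (force simp: weight_add_axis)
    then show ?thesis using 3 by simp
  qed
qed

text \<open>
  Each vector of weight \<open>i + 1\<close> arises from \<open>i + 1\<close> vectors of weight \<open>i\<close> by a single flip, each
  vector of weight \<open>i - 1\<close> from \<open>n + 1 - i\<close> of them. The second sum is indexed by
  \<open>weight x + 1 = i\<close> to be empty at \<open>i = 0\<close>.
\<close>

lemma sum_flips:
  fixes \<phi> :: "bit ^ 'n \<Rightarrow> real"
  shows "(\<Sum>x | weight x = i. \<Sum>j\<in>UNIV. \<phi> (x + axis j 1)) =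
    real (i + 1) * (\<Sum>x | weight x = i + 1. \<phi> x) +
    real (CARD('n) + 1 - i) * (\<Sum>x | weight x + 1 = i. \<phi> x)"
proof -
  have "(\<Sum>x | weight x = i. \<Sum>j\<in>UNIV. \<phi> (x + axis j 1)) =
      (\<Sum>j\<in>UNIV. \<Sum>x | weight x = i. \<phi> (x + axis j 1))"
    by (rule sum.swap)
  also have "\<dots> = (\<Sum>j\<in>UNIV. \<Sum>x | weight (x + axis j 1) = i. \<phi> x)"
  proof (rule sum.cong[OF refl])
    fix j :: 'n
    show "(\<Sum>x | weight x = i. \<phi> (x + axis j 1)) = (\<Sum>x | weight (x + axis j 1) = i. \<phi> x)"
      by (rule sum.reindex_bij_witness[where i = "\<lambda>x. x + axis j 1" and j = "\<lambda>x. x + axis j 1"])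
        simp_all
  qed
  also have "\<dots> = (\<Sum>x\<in>UNIV. \<Sum>j | weight (x + axis j 1) = i. \<phi> x)"
    using sum.swap_restrict[of UNIV UNIV "\<lambda>j x. \<phi> x" "\<lambda>j x. weight (x + axis j 1) = i"] by simp
  also have "\<dots> = (\<Sum>x\<in>UNIV. (if weight x = i + 1 then real (i + 1) * \<phi> x else 0) +
      (if weight x + 1 = i then real (CARD('n) + 1 - i) * \<phi> x else 0))"
    by (intro sum.cong) (auto simp: card_flips_of_weight)
  also have "\<dots> = real (i + 1) * (\<Sum>x | weight x = i + 1. \<phi> x) +
    real (CARD('n) + 1 - i) * (\<Sum>x | weight x + 1 = i. \<phi> x)"
    by (simp add: sum.distrib sum.If_cases sum_distrib_left)
  finally show ?thesis .
qed

text \<open>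
  The three-term recurrence of the Krawtchouk polynomials. Multiplying \<open>f\<close> by the sum of the unit
  vector characters replaces \<open>v + x\<close> by its single-coordinate flips.
\<close>

lemma char_moment_mult:
  fixes v :: "bit ^ 'n"
  shows "char_moment v D i (\<lambda>y. krawtchouk_one y * f y) =
    real (i + 1) * char_moment v D (i + 1) f +
    real (CARD('n) + 1 - i) * (\<Sum>x | weight x + 1 = i. \<Sum>y\<in>D. chi (v + x) y * f y)"
proof -
  have "char_moment v D i (\<lambda>y. krawtchouk_one y * f y) =
      (\<Sum>x | weight x = i. \<Sum>j\<in>UNIV. \<Sum>y\<in>D. chi (v + (x + axis j 1)) y * f y)"
    unfolding char_moment_def sum_chi_axis[symmetric]
    by (subst sum.swap)
      (simp add: chi_add sum_distrib_left sum_distrib_right mult.assoc)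
  then show ?thesis
    using sum_flips[of "\<lambda>x. \<Sum>y\<in>D. chi (v + x) y * f y" i] by (simp only: char_moment_def)
qed

lemma char_moment_mult_0:
  "char_moment v D 0 (\<lambda>y. krawtchouk_one y * f y) = char_moment v D 1 f"
  by (simp add: char_moment_mult)

lemma char_moment_mult_Suc:
  "char_moment v D (Suc i) (\<lambda>y. krawtchouk_one y * f y) =
    real (i + 2) * char_moment v D (i + 2) f + real (CARD('n) - i) * char_moment v D i f"
  for v :: "bit ^ 'n"
  by (simp add: char_moment_mult) (simp add: char_moment_def)

lemma char_moment_linear:
  "char_moment v D i (\<lambda>y. f y - a * g y) = char_moment v D i f - a * char_moment v D i g"
  by (simp add: char_moment_def right_diff_distrib sum_subtractf sum_distrib_left mult.left_commute)

lemma char_moment_0: "char_moment v D 0 f = (\<Sum>y\<in>D. chi v y * f y)" for v :: "bit ^ 'a"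
proof -
  have "{x. weight x = 0} = {0 :: bit ^ 'a}" by auto
  then show ?thesis by (simp add: char_moment_def del: weight_eq_0_iff)
qed

lemma char_moment_const:
  assumes "vec.subspace D"
  shows "char_moment v D i (\<lambda>_. 1) = real (card D) * real (card {x. weight x = i \<and> v + x \<in> dual D})"
proof -
  have "char_moment v D i (\<lambda>_. 1) = (\<Sum>x | weight x = i. if v + x \<in> dual D then real (card D) else 0)"
    by (simp add: char_moment_def sum_chi_subspace[OF assms])
  also have "\<dots> = real (card D) * real (card {x. weight x = i \<and> v + x \<in> dual D})"
    by (simp add: sum.If_cases Int_def mult.commute)
  finally show ?thesis .
qed

text \<open>
  By the recurrence, each factor of degree one moves the index by at most one. So a product of
  \<open>card A\<close> factors at index \<open>i\<close> only involves moments of index at most \<open>i + card A\<close>.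
\<close>

lemma char_moment_prod_eq_0:
  assumes "\<And>j. j \<le> s \<Longrightarrow> char_moment v D j f = 0" "finite A" "i + card A \<le> s"
  shows "char_moment v D i (\<lambda>y. (\<Prod>a\<in>A. krawtchouk_one y - a) * f y) = 0"
  using assms(2,3)
proof (induction A arbitrary: i rule: finite_induct)
  case empty
  then show ?case using assms(1) by simp
next
  case (insert a A)
  let ?g = "\<lambda>y. (\<Prod>a\<in>A. krawtchouk_one y - a) * f y"
  have IH: "char_moment v D j ?g = 0" if "j \<le> i + 1" for j
    using insert.prems insert.hyps that by (intro insert.IH) simp
  have "char_moment v D i (\<lambda>y. krawtchouk_one y * ?g y) = 0"
    using IH by (cases i) (auto simp: char_moment_mult_0 char_moment_mult_Suc)
  then have "char_moment v D i (\<lambda>y. krawtchouk_one y * ?g y - a * ?g y) = 0"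
    using IH[of i] by (simp only: char_moment_linear le_add1 mult_zero_right diff_0_right)
  moreover have "(\<lambda>y. (\<Prod>a\<in>insert a A. krawtchouk_one y - a) * f y) =
      (\<lambda>y. krawtchouk_one y * ?g y - a * ?g y)"
    using insert.hyps by (simp add: fun_eq_iff left_diff_distrib mult.assoc)
  ultimately show ?case by simp
qed

lemma covers_iff:
  "(\<Union>c\<in>C. {x. hamming_dist x c \<le> R}) = UNIV \<longleftrightarrow> (\<forall>v. \<exists>x. weight x \<le> R \<and> v + x \<in> C)"
  for C :: "(bit ^ 'n) set"
proof -
  have "(\<exists>c\<in>C. hamming_dist v c \<le> R) \<longleftrightarrow> (\<exists>x. weight x \<le> R \<and> v + x \<in> C)" for v
    unfolding hamming_dist_eq_weight by (metis vector_add_self_left)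
  then show ?thesis by blast
qed

lemma covering_radius_alt:
  "covering_radius C = (LEAST R. \<forall>v. \<exists>x. weight x \<le> R \<and> v + x \<in> C)"
  unfolding covering_radius_def covers_iff ..

lemma covering_radius_le:
  assumes "\<And>v. \<exists>x. weight x \<le> R \<and> v + x \<in> C"
  shows "covering_radius C \<le> R"
  unfolding covering_radius_alt using assms by (intro Least_le) blast

lemma within_covering_radius:
  fixes C :: "(bit ^ 'n) set"
  assumes "C \<noteq> {}"
  shows "\<exists>x. weight x \<le> covering_radius C \<and> v + x \<in> C"
proof -
  obtain c where c: "c \<in> C" using assms by blast
  have "weight x \<le> CARD('n)" for x :: "bit ^ 'n"
    unfolding weight_def by (rule card_mono) auto
  moreover have "w + (w + c) \<in> C" for w
    using c by simp
  ultimately have "\<forall>w. \<exists>x. weight x \<le> CARD('n) \<and> w + x \<in> C" by blast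
  then have "\<forall>w. \<exists>x. weight x \<le> covering_radius C \<and> w + x \<in> C"
    unfolding covering_radius_alt by (rule LeastI)
  then show ?thesis by blast
qed

text \<open>
  The coset farthest from the code contains a vector of weight exactly the covering radius, which
  has minimum weight in it.
\<close>

lemma deep_hole_leader:
  assumes C: "vec.subspace C"
  obtains v where "weight v = covering_radius C" "\<And>x. v + x \<in> C \<Longrightarrow> covering_radius C \<le> weight x"
proof -
  have ne: "C \<noteq> {}" using C by (auto simp: subspace_bit_iff)
  have "\<exists>w. \<forall>x. w + x \<in> C \<longrightarrow> covering_radius C \<le> weight x"
  proof (cases "covering_radius C")
    case (Suc R)
    then have "\<not> (\<forall>w. \<exists>x. weight x \<le> R \<and> w + x \<in> C)"
      unfolding covering_radius_alt by (intro not_less_Least) simp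
    then show ?thesis
      unfolding Suc by (metis not_less_eq_eq)
  qed simp
  then obtain w where w: "\<And>x. w + x \<in> C \<Longrightarrow> covering_radius C \<le> weight x" by blast
  obtain v where v: "weight v \<le> covering_radius C" "w + v \<in> C"
    using within_covering_radius[OF ne] by blast
  show ?thesis
  proof (rule that[of v])
    show "weight v = covering_radius C" using v w by (simp add: le_antisym)
    fix x assume "v + x \<in> C"
    then have "(w + v) + (v + x) \<in> C"
      using v(2) C by (simp only: subspace_bit_iff)
    then show "covering_radius C \<le> weight x"
      by (intro w) (simp only: add.assoc vector_add_self_left)
  qed
qed

text \<open>
  If a coset \<open>v + C\<close> had no vector of weight at most the number \<open>s\<close> of non-zero dual weights, then
  every polynomial of degree at most \<open>s\<close> in the weight would have a vanishing \<open>v\<close>-twisted sum over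
  the dual. The polynomial that vanishes at the non-zero dual weights has degree \<open>s\<close>, and its
  sum reduces to its non-zero value at the zero word.
\<close>

theorem delsarte_covering_bound:
  fixes C :: "(bit ^ 'n) set"
  assumes C: "vec.subspace C"
  shows "covering_radius C \<le> delsarte_bound C"
proof (rule covering_radius_le, rule ccontr)
  fix v
  assume no: "\<not> (\<exists>x. weight x \<le> delsarte_bound C \<and> v + x \<in> C)"
  define W where "W = {i. 0 < i \<and> i \<le> CARD('n) \<and> weight_count (dual C) i \<noteq> 0}"
  define A where "A = (\<lambda>i. real CARD('n) - 2 * real i) ` W"
  have W: "finite W" "card W = delsarte_bound C"
    unfolding W_def delsarte_bound_def by simp_all
  have A: "finite A" "card A \<le> delsarte_bound C"
    unfolding A_def using W card_image_le[OF W(1)] by simp_all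
  have mem: "weight y \<in> W" if "y \<in> dual C" "y \<noteq> 0" for y
  proof -
    have "weight y \<le> CARD('n)"
      unfolding weight_def by (rule card_mono) auto
    moreover have "0 < weight y"
      using that(2) by (intro gr0I) simp
    moreover have "y \<in> {x \<in> dual C. weight x = weight y}"
      using that(1) by simp
    then have "{x \<in> dual C. weight x = weight y} \<noteq> {}"
      by blast
    then have "weight_count (dual C) (weight y) \<noteq> 0"
      unfolding weight_count_def by (simp only: card_0_eq[OF finite] not_False_eq_True)
    ultimately show ?thesis
      unfolding W_def by simp
  qed
  have "char_moment v (dual C) j (\<lambda>_. 1) = 0" if "j \<le> delsarte_bound C" for j
    using no that by (auto simp: char_moment_const[OF subspace_dual] dual_dual[OF C])
  then have "char_moment v (dual C) 0 (\<lambda>y. (\<Prod>a\<in>A. krawtchouk_one y - a) * 1) = 0"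
    by (rule char_moment_prod_eq_0[where s = "delsarte_bound C"]) (use A in simp_all)
  then have "(\<Sum>y\<in>dual C. chi v y * (\<Prod>a\<in>A. krawtchouk_one y - a)) = 0"
    by (simp add: char_moment_0)
  moreover have "(\<Sum>y\<in>dual C. chi v y * (\<Prod>a\<in>A. krawtchouk_one y - a)) =
      (\<Sum>y\<in>{0}. chi v y * (\<Prod>a\<in>A. krawtchouk_one y - a))"
  proof (rule sum.mono_neutral_right)
    show "\<forall>y\<in>dual C - {0}. chi v y * (\<Prod>a\<in>A. krawtchouk_one y - a) = 0"
      using mem W(1) by (auto simp: A_def krawtchouk_one_def)
  qed (use subspace_dual in \<open>auto simp: subspace_bit_iff\<close>)
  moreover have "(\<Prod>a\<in>A. krawtchouk_one (0 :: bit ^ 'n) - a) \<noteq> 0"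
    using W(1) by (auto simp: A_def krawtchouk_one_def W_def)
  ultimately show False by simp
qed

section \<open>Doubly even subcodes, shadows and neighbors\<close>

lemma i_power_weight_add:
  "\<i> ^ weight (x + y) = \<i> ^ weight x * \<i> ^ weight y * of_real (chi x y)" for x y :: "bit ^ 'n"
proof -
  define m where "m = card {i. x $ i \<noteq> 0 \<and> y $ i \<noteq> 0}"
  have chi: "chi x y = (- 1) ^ m"
    unfolding chi_def scalar_product_eq_0_iff m_def[symmetric] by simp
  have "weight (x + y) + 2 * m = weight x + weight y"
    unfolding m_def by (rule weight_add)
  then have "\<i> ^ weight x * \<i> ^ weight y = \<i> ^ weight (x + y) * (- 1) ^ m"
    by (metis power_add power_mult i_squared power2_eq_square)
  then show ?thesis
    unfolding chi by (simp add: mult.assoc flip: power_mult_distrib)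
qed

lemma sum_i_power_weight: "(\<Sum>x\<in>(UNIV :: (bit ^ 'n) set). \<i> ^ weight x) = (1 + \<i>) ^ CARD('n)"
proof -
  let ?v = "\<lambda>S. \<chi> i. (if i \<in> S then 1 else 0 :: bit)"
  have "(1 + \<i>) ^ CARD('n) = (\<Prod>i\<in>(UNIV :: 'n set). \<i> + 1)"
    by (simp add: add.commute)
  also have "\<dots> = (\<Sum>S\<in>Pow (UNIV :: 'n set). \<i> ^ card S)"
    by (subst prod_add) simp_all
  also have "\<dots> = (\<Sum>x\<in>(UNIV :: (bit ^ 'n) set). \<i> ^ weight x)"
    by (rule sum.reindex_bij_witness[where i = "\<lambda>x. {i. x $ i \<noteq> 0}" and j = ?v])
      (auto simp: weight_def vec_eq_iff)
  finally show ?thesis ..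
qed

text \<open>
  The MacWilliams transform of \<open>\<i>\<^bsup>wt x\<^esup>\<close>: averaging the Gauss sum over
  translations by \<open>U\<close> multiplies each term by a character sum over \<open>U\<close>, because the words of \<open>U\<close>
  themselves contribute 1. Only the dual of \<open>U\<close> survives.
\<close>

lemma sum_i_power_weight_dual:
  fixes U :: "(bit ^ 'n) set"
  assumes U: "vec.subspace U" and de: "\<forall>x\<in>U. weight x mod 4 = 0"
  shows "(\<Sum>x\<in>dual U. \<i> ^ weight x) = (1 + \<i>) ^ CARD('n)"
proof -
  have one: "\<i> ^ weight c = 1" if c: "c \<in> U" for c
  proof -
    have "4 dvd weight c" using de c by auto
    then obtain q where "weight c = 4 * q" by (rule dvdE)
    then show ?thesis by (simp add: power_mult)
  qed
  have "of_nat (card U) * (\<Sum>x\<in>(UNIV :: (bit ^ 'n) set). \<i> ^ weight x) = (\<Sum>c\<in>U. \<Sum>x\<in>UNIV. \<i> ^ weight (x + c))"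
  proof -
    have "(\<Sum>x\<in>UNIV. \<i> ^ weight (x + c)) = (\<Sum>x\<in>(UNIV :: (bit ^ 'n) set). \<i> ^ weight x)"
      for c :: "bit ^ 'n"
      by (rule sum.reindex_bij_witness[where i = "\<lambda>x. x + c" and j = "\<lambda>x. x + c"]) simp_all
    then show ?thesis by simp
  qed
  also have "\<dots> = (\<Sum>x\<in>UNIV. \<Sum>c\<in>U. \<i> ^ weight (x + c))"
    by (rule sum.swap)
  also have "\<dots> = (\<Sum>x\<in>UNIV. \<i> ^ weight x * of_real (\<Sum>c\<in>U. chi x c))"
    by (simp add: i_power_weight_add one sum_distrib_left)
  also have "\<dots> = (\<Sum>x\<in>UNIV. if x \<in> dual U then of_nat (card U) * \<i> ^ weight x else 0)"
    by (intro sum.cong) (simp_all add: sum_chi_subspace[OF U])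
  also have "\<dots> = of_nat (card U) * (\<Sum>x\<in>dual U. \<i> ^ weight x)"
    by (simp add: sum.If_cases sum_distrib_left)
  finally have "of_nat (card U) * (1 + \<i>) ^ CARD('n) = of_nat (card U) * (\<Sum>x\<in>dual U. \<i> ^ weight x)"
    unfolding sum_i_power_weight .
  moreover have "card U \<noteq> 0"
    using U by (auto simp: subspace_bit_iff)
  ultimately show ?thesis by simp
qed

lemma self_dual_scalar_product: "self_dual C \<Longrightarrow> x \<in> C \<Longrightarrow> y \<in> C \<Longrightarrow> scalar_product x y = 0"
  unfolding self_dual_def dual_def by blast

lemma weight_add_mod_4_orthogonal:
  assumes "scalar_product x y = 0"
  shows "weight (x + y) mod 4 = (weight x + weight y) mod 4"
proof -
  obtain m where "card {i. x $ i \<noteq> 0 \<and> y $ i \<noteq> 0} = 2 * m"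
    using assms unfolding scalar_product_eq_0_iff by (rule evenE)
  then have "weight x + weight y = weight (x + y) + m * 4"
    using weight_add[of x y] by simp
  then show ?thesis by simp
qed

lemma weight_add_mod_4_not_orthogonal:
  assumes "scalar_product x y \<noteq> 0"
  shows "(weight (x + y) + 2) mod 4 = (weight x + weight y) mod 4"
proof -
  obtain m where "card {i. x $ i \<noteq> 0 \<and> y $ i \<noteq> 0} = 2 * m + 1"
    using assms unfolding scalar_product_eq_0_iff by (rule oddE)
  then have "weight x + weight y = weight (x + y) + 2 + m * 4"
    using weight_add[of x y] by simp
  then show ?thesis by (simp only: mod_mult_self1)
qed

lemma self_dual_even_weight: "self_dual C \<Longrightarrow> x \<in> C \<Longrightarrow> even (weight x)"
  using self_dual_scalar_product scalar_product_self_eq_0_iff by blast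

lemma one_mem_self_dual: "self_dual C \<Longrightarrow> 1 \<in> C"
proof -
  assume C: "self_dual C"
  then have "1 \<in> dual C"
    unfolding dual_def using self_dual_even_weight scalar_product_one_eq_0_iff by blast
  then show ?thesis using C by (simp add: self_dual_def)
qed

lemma subspace_doubly_even_subcode:
  assumes C: "self_dual C"
  shows "vec.subspace (doubly_even_subcode C)"
proof -
  have "weight (x + y) mod 4 = 0"
    if "x \<in> C" "y \<in> C" "weight x mod 4 = 0" "weight y mod 4 = 0" for x y
    using weight_add_mod_4_orthogonal[OF self_dual_scalar_product[OF C that(1,2)]] that(3,4) by presburger
  moreover have "weight (0 :: bit ^ 'a) = 0" by simp
  ultimately show ?thesis
    using C unfolding self_dual_def subspace_bit_iff doubly_even_subcode_def by auto
qed

text \<open>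
  On a self-dual code the weight modulo 4 is additive with values 0 and 2; adding a word \<open>t\<close> of
  weight 2 modulo 4 exchanges the two classes.
\<close>

lemma card_doubly_even_subcode:
  assumes C: "singly_even_self_dual C"
  shows "2 * card (doubly_even_subcode C) = card C"
proof -
  have sd: "self_dual C" and sub: "vec.subspace C"
    using C by (simp_all add: singly_even_self_dual_def self_dual_def)
  obtain t where t: "t \<in> C" "weight t mod 4 = 2"
    using C by (auto simp: singly_even_self_dual_def)
  have flip: "t + x \<in> C" "weight (t + x) mod 4 = (2 + weight x) mod 4" if "x \<in> C" for x
    using that sub t(1) weight_add_mod_4_orthogonal[OF self_dual_scalar_product[OF sd t(1) that]] t(2)
    by (auto simp: subspace_bit_iff mod_add_left_eq[symmetric, of "weight t"])
  have eq: "(+) t ` doubly_even_subcode C = C - doubly_even_subcode C"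
  proof (intro set_eqI iffI)
    fix x assume "x \<in> (+) t ` doubly_even_subcode C"
    then have tx: "t + x \<in> C" "weight (t + x) mod 4 = 0"
      by (auto simp: mem_translate_iff doubly_even_subcode_def)
    have "x \<in> C" "weight x mod 4 = (2 + weight (t + x)) mod 4"
      using flip[OF tx(1)] by simp_all
    moreover from this tx(2) have "weight x mod 4 \<noteq> 0" by presburger
    ultimately show "x \<in> C - doubly_even_subcode C"
      by (simp add: doubly_even_subcode_def)
  next
    fix x assume x: "x \<in> C - doubly_even_subcode C"
    then have "weight x mod 4 \<noteq> 0" "even (weight x)"
      using self_dual_even_weight[OF sd, of x] by (auto simp: doubly_even_subcode_def)
    moreover have "weight (t + x) mod 4 = (2 + weight x) mod 4"
      using flip(2)[of x] x by blast
    ultimately have "weight (t + x) mod 4 = 0" by presburger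
    then show "x \<in> (+) t ` doubly_even_subcode C"
      using flip(1)[of x] x by (simp add: mem_translate_iff doubly_even_subcode_def)
  qed
  have "doubly_even_subcode C \<subseteq> C" by (auto simp: doubly_even_subcode_def)
  then have "card C = card (doubly_even_subcode C) + card (C - doubly_even_subcode C)"
    by (metis Diff_disjoint Un_Diff_cancel card_Un_disjoint finite sup.absorb_iff2 sup_commute)
  then show ?thesis
    unfolding eq[symmetric] card_translate by simp
qed

lemma self_dual_subset_dual_subcode:
  assumes "self_dual C"
  shows "C \<subseteq> dual (doubly_even_subcode C)"
  using dual_antimono[of "doubly_even_subcode C" C] assms
  by (auto simp: self_dual_def doubly_even_subcode_def)

lemma card_shadow:
  assumes C: "singly_even_self_dual C"
  shows "card (shadow C) = card C"
proof -
  let ?C0 = "doubly_even_subcode C"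
  have sd: "self_dual C" using C by (simp add: singly_even_self_dual_def)
  have "card (dual ?C0) * card ?C0 = card C * card C"
    using card_dual[OF subspace_doubly_even_subcode[OF sd]] self_dual_card[OF sd] by simp
  also have "\<dots> = (2 * card C) * card ?C0"
    using card_doubly_even_subcode[OF C] by (metis mult.assoc mult.commute)
  finally have "card (dual ?C0) * card ?C0 = (2 * card C) * card ?C0" .
  moreover have "card ?C0 \<noteq> 0"
    using subspace_doubly_even_subcode[OF sd] by (auto simp: subspace_bit_iff)
  ultimately have "card (dual ?C0) = 2 * card C"
    by (metis mult_right_cancel)
  then show ?thesis
    unfolding shadow_def using card_Diff_subset[OF _ self_dual_subset_dual_subcode[OF sd]] by simp
qed

lemma i_power_mod_4: "\<i> ^ n = \<i> ^ (n mod 4)"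
proof -
  have "\<i> ^ n = \<i> ^ (4 * (n div 4) + n mod 4)" by simp
  also have "\<dots> = \<i> ^ (n mod 4)"
    unfolding power_add power_mult by simp
  finally show ?thesis .
qed

text \<open>
  The sum of \<open>\<i>\<^bsup>wt x\<^esup>\<close> over the dual of \<open>C\<^sub>0\<close> equals
  \<open>(1 + \<i>)\<^bsup>n\<^esup> = 2\<^bsup>n/2\<^esup>\<close>. The two halves of \<open>C\<close> cancel, so this is the sum over
  the shadow, which has \<open>2\<^bsup>n/2\<^esup>\<close> elements. A sum of that many numbers of modulus 1 can only
  reach this value if each of them is 1.
\<close>

lemma shadow_weight_mod_4:
  fixes C :: "(bit ^ 'n) set"
  assumes C: "singly_even_self_dual C" and n: "8 dvd CARD('n)" and x: "x \<in> shadow C"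
  shows "weight x mod 4 = 0"
proof -
  let ?C0 = "doubly_even_subcode C"
  have sd: "self_dual C" using C by (simp add: singly_even_self_dual_def)
  obtain m where m: "CARD('n) = 8 * m" using n by (rule dvdE)
  have "(card C)\<^sup>2 = (16 ^ m)\<^sup>2"
    using self_dual_card[OF sd] unfolding m power_mult[symmetric] power2_eq_square
    by (simp add: power_mult power_mult_distrib[symmetric])
  then have card: "card C = 16 ^ m"
    by (simp add: power2_eq_iff_nonneg)
  \<comment> \<open>Weights 0 and 2 modulo 4 occur equally often in \<open>C\<close>.\<close>
  have "(\<Sum>x\<in>C. \<i> ^ weight x) = 0"
  proof -
    have "(\<Sum>x\<in>C. \<i> ^ weight x) = (\<Sum>x\<in>C. if x \<in> ?C0 then 1 else - 1)"
    proof (rule sum.cong[OF refl])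
      fix x assume x: "x \<in> C"
      then have "weight x mod 4 = 0 \<or> weight x mod 4 = 2"
        using self_dual_even_weight[OF sd, of x] by presburger
      then show "\<i> ^ weight x = (if x \<in> ?C0 then 1 else - 1)"
        using x i_power_mod_4[of "weight x"] by (auto simp: doubly_even_subcode_def)
    qed
    also have "\<dots> = of_nat (card ?C0) - of_nat (card (C - ?C0))"
    proof -
      have "C \<inter> {x. x \<in> ?C0} = ?C0" "C \<inter> - {x. x \<in> ?C0} = C - ?C0"
        by (auto simp: doubly_even_subcode_def)
      then show ?thesis by (simp add: sum.If_cases)
    qed
    also have "card (C - ?C0) = card ?C0"
      using card_doubly_even_subcode[OF C] card_Diff_subset[of ?C0 C]
      by (simp add: doubly_even_subcode_def)
    finally show ?thesis by simp
  qed
  moreover have "(\<Sum>x\<in>dual ?C0. \<i> ^ weight x) = 16 ^ m"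
  proof -
    \<comment> \<open>\<open>1 + \<i>\<close> is \<open>sqrt 2\<close> times a primitive 8th root of unity.\<close>
    have "(1 + \<i>) ^ 8 = (((1 + \<i>)\<^sup>2)\<^sup>2)\<^sup>2" by simp
    also have "\<dots> = 16" by (simp add: power2_eq_square algebra_simps)
    finally show ?thesis
      using sum_i_power_weight_dual[OF subspace_doubly_even_subcode[OF sd]]
      by (simp add: m power_mult doubly_even_subcode_def)
  qed
  moreover have "(\<Sum>x\<in>dual ?C0. \<i> ^ weight x) = (\<Sum>x\<in>shadow C. \<i> ^ weight x) + (\<Sum>x\<in>C. \<i> ^ weight x)"
    unfolding shadow_def using self_dual_subset_dual_subcode[OF sd] by (intro sum.subset_diff) simp_all
  ultimately have "(\<Sum>x\<in>shadow C. \<i> ^ weight x) = of_nat (card (shadow C))"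
    by (simp add: card_shadow[OF C] card)
  then have "Re (\<Sum>x\<in>shadow C. \<i> ^ weight x) = real (card (shadow C))" by simp
  then have sum0: "(\<Sum>x\<in>shadow C. 1 - Re (\<i> ^ weight x)) = 0"
    by (simp add: sum_subtractf)
  have le: "0 \<le> 1 - Re (\<i> ^ weight y)" for y :: "bit ^ 'n"
    using complex_Re_le_cmod[of "\<i> ^ weight y"] by (simp add: norm_power)
  have "1 - Re (\<i> ^ weight x) = 0"
    using sum0 le x sum_nonneg_eq_0_iff[of "shadow C" "\<lambda>x. 1 - Re (\<i> ^ weight x)"] by simp
  then have re: "Re (\<i> ^ (weight x mod 4)) = 1"
    by (subst i_power_mod_4[symmetric]) simp
  have "weight x mod 4 \<in> {0, 1, 2, 3}" by auto
  then show ?thesis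
    using re by (elim insertE emptyE) (simp_all add: numeral_3_eq_3)
qed

lemma subspace_Un_translate:
  fixes U :: "(bit ^ 'n) set"
  assumes "vec.subspace U"
  shows "vec.subspace (U \<union> (+) u ` U)"
proof -
  have "x + y \<in> U \<or> u + (x + y) \<in> U" if "x \<in> U \<or> u + x \<in> U" "y \<in> U \<or> u + y \<in> U" for x y
  proof -
    have *: "(u + x) + y = u + (x + y)" "x + (u + y) = u + (x + y)" "(u + x) + (u + y) = x + y"
      by (simp_all add: add.assoc add.left_commute[of x u])
    show ?thesis
      using that assms * unfolding subspace_bit_iff by metis
  qed
  then show ?thesis
    using assms by (auto simp: subspace_bit_iff mem_translate_iff)
qed

lemma card_Un_translate:
  fixes U :: "(bit ^ 'n) set"
  assumes U: "vec.subspace U" and u: "u \<notin> U"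
  shows "card (U \<union> (+) u ` U) = 2 * card U"
proof -
  have "U \<inter> (+) u ` U = {}"
    using u subspace_add_mem_iff[OF U] by (auto simp: mem_translate_iff)
  then show ?thesis
    by (simp add: card_Un_disjoint card_translate)
qed

lemma translate_mem_eq:
  fixes U :: "(bit ^ 'n) set"
  assumes U: "vec.subspace U" and w: "w \<in> (+) u ` U"
  shows "(+) u ` U = (+) w ` U"
proof -
  have "u + x \<in> U \<longleftrightarrow> w + x \<in> U" for x
  proof -
    have "w + x + (u + w) = (w + w) + (u + x)"
      by (simp only: add.assoc add.commute add.left_commute)
    then have "u + x = w + x + (u + w)" by (simp only: vector_add_self add_0_left)
    moreover have "u + w \<in> U" using w by (simp only: mem_translate_iff)
    ultimately show ?thesis
      using subspace_add_mem_iff[OF U] by metis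
  qed
  then show ?thesis by (auto simp: mem_translate_iff set_eq_iff)
qed

lemma self_dual_dim:
  fixes C :: "(bit ^ 'n) set"
  assumes C: "self_dual C"
  shows "2 * vec.dim C = CARD('n)"
proof -
  have "vec.subspace C" using C by (simp add: self_dual_def)
  then have "(2 :: nat) ^ (2 * vec.dim C) = 2 ^ CARD('n)"
    using self_dual_card[OF C] by (simp only: card_subspace mult_2 power_add)
  then show ?thesis by simp
qed

lemma neighbors_iff_card:
  fixes C :: "(bit ^ 'n) set"
  assumes C: "self_dual C" and D: "self_dual D"
  shows "neighbors C D \<longleftrightarrow> 2 * card (C \<inter> D) = card C"
proof -
  have sub: "vec.subspace C" "vec.subspace D" using C D by (simp_all add: self_dual_def)
  have subI: "vec.subspace (C \<inter> D)" using sub by (rule vec.subspace_inter)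
  have "2 * card (C \<inter> D) = card C \<longleftrightarrow> (2 :: nat) ^ (Suc (vec.dim (C \<inter> D))) = 2 ^ vec.dim C"
    by (simp add: card_subspace[OF sub(1)] card_subspace[OF subI])
  also have "\<dots> \<longleftrightarrow> Suc (vec.dim (C \<inter> D)) = vec.dim C"
    by (rule power_inject_exp) simp
  also have "\<dots> \<longleftrightarrow> neighbors C D"
    unfolding neighbors_def self_dual_dim[OF C, symmetric] using C D by auto
  finally show ?thesis ..
qed

lemma translate_subcode_subset_shadow:
  assumes C: "self_dual C" and u: "u \<in> shadow C"
  shows "(+) u ` doubly_even_subcode C \<subseteq> shadow C"
proof
  fix x assume x: "x \<in> (+) u ` doubly_even_subcode C"
  then obtain c where c: "c \<in> doubly_even_subcode C" "x = u + c" by blast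
  then have "c \<in> C" "c \<in> dual (doubly_even_subcode C)"
    using self_dual_subset_dual_subcode[OF C] by (auto simp: doubly_even_subcode_def)
  then show "x \<in> shadow C"
    using u C subspace_add_mem_iff[OF subspace_dual, of c _ u] subspace_add_mem_iff[of C c u]
    by (simp add: c(2) shadow_def self_dual_def)
qed

lemma doubly_even_neighbor:
  fixes C :: "(bit ^ 'n) set"
  assumes C: "singly_even_self_dual C" and n: "8 dvd CARD('n)" and u: "u \<in> shadow C"
  defines "D \<equiv> doubly_even_subcode C \<union> (+) u ` doubly_even_subcode C"
  shows "doubly_even_self_dual D" "neighbors C D"
proof -
  let ?C0 = "doubly_even_subcode C"
  have sd: "self_dual C" using C by (simp add: singly_even_self_dual_def)
  note sub0 = subspace_doubly_even_subcode[OF sd]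
  have "?C0 \<subseteq> C" by (auto simp: doubly_even_subcode_def)
  have "u \<notin> ?C0" using u \<open>?C0 \<subseteq> C\<close> by (auto simp: shadow_def)
  have sub: "vec.subspace D" unfolding D_def by (rule subspace_Un_translate[OF sub0])
  have card: "card D = card C"
    unfolding D_def card_Un_translate[OF sub0 \<open>u \<notin> ?C0\<close>] by (rule card_doubly_even_subcode[OF C])
  have de: "\<forall>x\<in>D. weight x mod 4 = 0"
  proof
    fix x assume "x \<in> D"
    then have "x \<in> ?C0 \<or> x \<in> shadow C"
      using translate_subcode_subset_shadow[OF sd u] unfolding D_def by blast
    then show "weight x mod 4 = 0"
      using shadow_weight_mod_4[OF C n, of x] unfolding doubly_even_subcode_def by blast
  qed
  have sdD: "self_dual D"
    using self_dualI[OF sub doubly_even_subspace_self_orthogonal[OF sub de]] self_dual_card[OF sd] card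
    by simp
  then show "doubly_even_self_dual D"
    using de by (simp add: doubly_even_self_dual_def)
  have "C \<inter> D = ?C0"
    using \<open>?C0 \<subseteq> C\<close> translate_subcode_subset_shadow[OF sd u] unfolding D_def shadow_def by blast
  then show "neighbors C D"
    using card_doubly_even_subcode[OF C] by (simp add: neighbors_iff_card[OF sd sdD])
qed

text \<open>
  A doubly even neighbor meets \<open>C\<close> in a doubly even subspace of index 2, which must be all of
  \<open>C\<^sub>0\<close>. Any further word of it lies in the shadow, and \<open>C\<^sub>0\<close> together with the coset of that
  word is already self-dual.
\<close>

lemma doubly_even_neighbors_eq:
  fixes C :: "(bit ^ 'n) set"
  assumes C: "singly_even_self_dual C" and n: "8 dvd CARD('n)"
  shows "{D. doubly_even_self_dual D \<and> neighbors C D} =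
    (\<lambda>u. doubly_even_subcode C \<union> (+) u ` doubly_even_subcode C) ` shadow C"
proof (intro set_eqI iffI)
  let ?C0 = "doubly_even_subcode C"
  have sd: "self_dual C" using C by (simp add: singly_even_self_dual_def)
  fix D assume "D \<in> {D. doubly_even_self_dual D \<and> neighbors C D}"
  then have de: "doubly_even_self_dual D" and nb: "neighbors C D" by simp_all
  then have sdD: "self_dual D" and subD: "vec.subspace D"
    by (simp_all add: doubly_even_self_dual_def self_dual_def)
  have "C \<inter> D \<subseteq> ?C0"
    using de by (auto simp: doubly_even_self_dual_def doubly_even_subcode_def)
  moreover have "card (C \<inter> D) = card ?C0"
    using nb card_doubly_even_subcode[OF C] by (simp add: neighbors_iff_card[OF sd sdD])
  ultimately have eq: "C \<inter> D = ?C0" by (simp add: card_subset_eq)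
  have "\<not> D \<subseteq> C"
  proof
    assume "D \<subseteq> C"
    then have "C = D" using self_dual_subset_eq[OF sdD sd] by simp
    then show False
      using C de by (auto simp: singly_even_self_dual_def doubly_even_self_dual_def)
  qed
  then obtain u where u: "u \<in> D" "u \<notin> C" by blast
  have "D \<subseteq> dual ?C0"
    using sdD dual_antimono[of ?C0 D] eq by (auto simp: self_dual_def)
  then have ush: "u \<in> shadow C" using u by (auto simp: shadow_def)
  have "?C0 \<union> (+) u ` ?C0 \<subseteq> D"
    using eq u(1) subD by (auto simp: subspace_bit_iff)
  then have "?C0 \<union> (+) u ` ?C0 = D"
    using doubly_even_neighbor(1)[OF C n ush] sdD
    by (intro self_dual_subset_eq) (simp_all add: doubly_even_self_dual_def)
  then show "D \<in> (\<lambda>u. ?C0 \<union> (+) u ` ?C0) ` shadow C" using ush by blast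
next
  fix D assume "D \<in> (\<lambda>u. doubly_even_subcode C \<union> (+) u ` doubly_even_subcode C) ` shadow C"
  then show "D \<in> {D. doubly_even_self_dual D \<and> neighbors C D}"
    using doubly_even_neighbor[OF C n] by auto
qed

section \<open>Covering radius forces extremality\<close>

text \<open>
  Complementation maps \<open>D\<close> to itself, so the lower bound on the weights also bounds
  the weights other than \<open>n\<close> from above. The multiples of 4 that remain number \<open>4 k + 2\<close>, counting
  \<open>n\<close>; if the Delsarte bound attains this number, all of them occur, among them \<open>4 k + 4\<close>.
\<close>

lemma delsarte_bound_doubly_even:
  fixes D :: "(bit ^ 'n) set"
  assumes n: "CARD('n) = 24 * k + 8" and D: "doubly_even_self_dual D"
    and d: "\<And>x. x \<in> D \<Longrightarrow> x \<noteq> 0 \<Longrightarrow> 4 * k + 4 \<le> weight x"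
  shows "delsarte_bound D \<le> 4 * k + 2"
    and "delsarte_bound D = 4 * k + 2 \<Longrightarrow> \<exists>x\<in>D. weight x = 4 * k + 4"
proof -
  define W where "W = {i. 0 < i \<and> i \<le> CARD('n) \<and> weight_count D i \<noteq> 0}"
  define V where "V = insert (24 * k + 8) ((*) 4 ` {k + 1..5 * k + 1})"
  have sd: "self_dual D" and de: "\<And>x. x \<in> D \<Longrightarrow> weight x mod 4 = 0"
    using D by (simp_all add: doubly_even_self_dual_def)
  have db: "delsarte_bound D = card W"
    using sd by (simp add: delsarte_bound_def W_def self_dual_def)
  have W: "i \<in> W \<Longrightarrow> 0 < i \<and> (\<exists>x\<in>D. weight x = i)" for i
    unfolding W_def weight_count_def by (auto simp: card_eq_0_iff)
  have finV: "finite V" and cardV: "card V = 4 * k + 2"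
  proof -
    have "24 * k + 8 \<notin> (*) 4 ` {k + 1..5 * k + 1}" by auto
    then show "card V = 4 * k + 2"
      unfolding V_def by (simp add: card_image inj_on_def)
  qed (simp add: V_def)
  have sub: "W \<subseteq> V"
  proof
    fix i assume "i \<in> W"
    then obtain x where x: "x \<in> D" "weight x = i" "0 < i" using W by blast
    then have "x \<noteq> 0" by auto
    show "i \<in> V"
    proof (cases "x = 1")
      case True
      then show ?thesis using x n by (simp add: V_def)
    next
      case False
      have "1 + x \<in> D"
        using one_mem_self_dual[OF sd] x sd by (simp add: self_dual_def subspace_bit_iff)
      then have "4 * k + 4 \<le> weight (1 + x)"
        using False by (intro d) (simp_all add: vector_add_eq_0_iff)
      then have le: "weight x \<le> 20 * k + 4"
        using weight_complement[of x] n by simp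
      have "4 dvd i" using de[OF x(1)] x(2) by auto
      then obtain q where q: "i = 4 * q" by (rule dvdE)
      have "4 * k + 4 \<le> i" using d[OF x(1) \<open>x \<noteq> 0\<close>] x(2) by simp
      then have "q \<in> {k + 1..5 * k + 1}" using le q x(2) by simp
      then show ?thesis unfolding V_def q by blast
    qed
  qed
  show "delsarte_bound D \<le> 4 * k + 2"
    unfolding db cardV[symmetric] by (rule card_mono[OF finV sub])
  assume "delsarte_bound D = 4 * k + 2"
  then have "W = V"
    using card_subset_eq[OF finV sub] db cardV by simp
  moreover have "4 * (k + 1) \<in> (*) 4 ` {k + 1..5 * k + 1}"
    by (rule imageI) simp
  ultimately have "4 * (k + 1) \<in> W" unfolding V_def by blast
  then show "\<exists>x\<in>D. weight x = 4 * k + 4" using W[of "4 * (k + 1)"] by (auto simp: add.commute)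
qed

text \<open>
  The coset of \<open>v\<close> bounds the covering radius from below, the Delsarte bound bounds it from
  above, and the two values agree.
\<close>

lemma extremal_of_deep_coset:
  fixes D :: "(bit ^ 'n) set"
  assumes n: "CARD('n) = 24 * k + 8" and D: "doubly_even_self_dual D"
    and d: "\<And>x. x \<in> D \<Longrightarrow> x \<noteq> 0 \<Longrightarrow> 4 * k + 4 \<le> weight x"
    and v: "\<And>x. v + x \<in> D \<Longrightarrow> 4 * k + 2 \<le> weight x"
  shows "covering_radius D = 4 * k + 2" "delsarte_bound D = 4 * k + 2" "min_weight D = 4 * k + 4"
proof -
  have sub: "vec.subspace D" using D by (simp add: doubly_even_self_dual_def self_dual_def)
  then have "D \<noteq> {}" by (auto simp: subspace_bit_iff)
  then obtain x where "weight x \<le> covering_radius D" "v + x \<in> D"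
    using within_covering_radius by blast
  then have "4 * k + 2 \<le> covering_radius D" using v[of x] by simp
  then show *: "covering_radius D = 4 * k + 2" "delsarte_bound D = 4 * k + 2"
    using delsarte_covering_bound[OF sub] delsarte_bound_doubly_even(1)[OF n D d] by simp_all
  obtain x where x: "x \<in> D" "weight x = 4 * k + 4"
    using delsarte_bound_doubly_even(2)[OF n D d *(2)] by blast
  then have "x \<noteq> 0" by auto
  then show "min_weight D = 4 * k + 4" using x d by (intro min_weight_eqI[of x])
qed

section \<open>The weight distribution of a deep coset\<close>

text \<open>
  From index \<open>i\<close>, the recurrence reaches index at most \<open>i + j\<close> in \<open>j\<close> steps, and all moments there
  vanish.
\<close>

lemma char_moment_power_eq_0:
  assumes "\<And>j. j < s \<Longrightarrow> char_moment v D j (\<lambda>_. 1) = 0" "i + j < s"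
  shows "char_moment v D i (\<lambda>y. krawtchouk_one y ^ j) = 0"
  using assms(2)
proof (induction j arbitrary: i)
  case 0
  then show ?case using assms(1) by simp
next
  case (Suc j)
  then show ?case
    by (cases i) (simp_all add: char_moment_mult_0 char_moment_mult_Suc)
qed

text \<open>
  Only the path that goes up in each of the \<open>j\<close> steps reaches index \<open>s\<close>. Its steps contribute the
  factors \<open>i + 1, \<dots>, s\<close>.
\<close>

lemma char_moment_power_leading:
  assumes "\<And>j. j < s \<Longrightarrow> char_moment v D j (\<lambda>_. 1) = 0" "i + j = s"
  shows "fact i * char_moment v D i (\<lambda>y. krawtchouk_one y ^ j) = fact s * char_moment v D s (\<lambda>_. 1)"
  using assms(2)
proof (induction j arbitrary: i)
  case 0
  then show ?case by simp
next
  case (Suc j)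
  show ?case
  proof (cases i)
    case 0
    have "fact 1 * char_moment v D 1 (\<lambda>y. krawtchouk_one y ^ j) = fact s * char_moment v D s (\<lambda>_. 1)"
      by (rule Suc.IH) (use Suc.prems 0 in simp)
    then show ?thesis
      by (simp add: 0 char_moment_mult_0)
  next
    case (Suc l)
    have "char_moment v D l (\<lambda>y. krawtchouk_one y ^ j) = 0"
      by (rule char_moment_power_eq_0[where s = s]) (use assms(1) Suc Suc.prems in simp_all)
    then show ?thesis
      using Suc.IH[of "l + 2"] Suc.prems Suc
      by (simp add: char_moment_mult_Suc algebra_simps)
  qed
qed

text \<open>
  With two steps to spare, either all steps go up, to index \<open>s + 2\<close>, or exactly one step goes
  down, ending at index \<open>s\<close>. A down step from index \<open>l\<close> has the factor \<open>n + 1 - l\<close>, and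
  the up step back to \<open>l\<close> has the factor \<open>l\<close>; these paths make up the sum. No term for index
  \<open>s + 1\<close> occurs, by parity of the number of steps.
\<close>

lemma char_moment_power_second:
  fixes v :: "bit ^ 'n"
  assumes "\<And>j. j < s \<Longrightarrow> char_moment v D j (\<lambda>_. 1) = 0" "i + j = s + 2"
  shows "fact i * char_moment v D i (\<lambda>y. krawtchouk_one y ^ j) =
    fact (s + 2) * char_moment v D (s + 2) (\<lambda>_. 1) +
    (\<Sum>l\<in>{i..s + 1}. real l * real (CARD('n) + 1 - l)) * (fact s * char_moment v D s (\<lambda>_. 1))"
  using assms(2)
proof (induction j arbitrary: i)
  case 0
  then show ?case by simp
next
  case (Suc j)
  show ?case
  proof (cases i)
    case 0
    have "(\<Sum>l\<in>{0..s + 1}. real l * real (CARD('n) + 1 - l)) =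
        (\<Sum>l\<in>{1..s + 1}. real l * real (CARD('n) + 1 - l))"
      by (rule sum.mono_neutral_right) auto
    moreover have "fact 1 * char_moment v D 1 (\<lambda>y. krawtchouk_one y ^ j) =
        fact (s + 2) * char_moment v D (s + 2) (\<lambda>_. 1) +
        (\<Sum>l\<in>{1..s + 1}. real l * real (CARD('n) + 1 - l)) * (fact s * char_moment v D s (\<lambda>_. 1))"
      by (rule Suc.IH) (use Suc.prems 0 in simp)
    ultimately show ?thesis
      by (simp only: 0 char_moment_mult_0 power_Suc fact_0 fact_1 mult_1_left)
  next
    case (Suc l)
    let ?S = "\<lambda>i. \<Sum>l\<in>{i..s + 1}. real l * real (CARD('n) + 1 - l)"
    let ?G = "\<lambda>i. char_moment v D i (\<lambda>y. krawtchouk_one y ^ j)"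
    let ?L = "fact s * char_moment v D s (\<lambda>_. 1)"
    \<comment> \<open>The down step leads to index \<open>l\<close> with \<open>l + j = s\<close>, so only up steps can follow.\<close>
    have lead: "fact l * ?G l = ?L"
      by (rule char_moment_power_leading) (use assms(1) Suc Suc.prems in simp_all)
    have "Suc l \<le> s + 1" using Suc Suc.prems by simp
    then have split: "?S (Suc l) = real (Suc l) * real (CARD('n) - l) + ?S (l + 2)"
      by (subst sum.atLeast_Suc_atMost) simp_all
    have "fact (Suc l) * char_moment v D (Suc l) (\<lambda>y. krawtchouk_one y ^ Suc j) =
        fact (l + 2) * ?G (l + 2) + real (Suc l) * real (CARD('n) - l) * (fact l * ?G l)"
      by (simp add: char_moment_mult_Suc algebra_simps)
    also have "fact (l + 2) * ?G (l + 2) =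
        fact (s + 2) * char_moment v D (s + 2) (\<lambda>_. 1) + ?S (l + 2) * ?L"
      using Suc.IH[of "l + 2"] Suc.prems Suc by simp
    finally show ?thesis
      unfolding Suc lead split by (simp only: distrib_right add_ac)
  qed
qed

text \<open>
  Terms of degree below \<open>s\<close> contribute nothing, so of the expanded product only the leading term
  matters when its degree is \<open>s\<close>, and the top two terms when it is \<open>s + 2\<close>.
\<close>

lemma char_moment_even_product:
  fixes a :: "nat \<Rightarrow> real" and v :: "bit ^ 'n" and D :: "(bit ^ 'n) set"
  defines "L \<equiv> \<lambda>j r. char_moment v D 0 (\<lambda>y. krawtchouk_one y ^ j * (\<Prod>l<r. (krawtchouk_one y)\<^sup>2 - a l))"
  assumes "\<And>j. j < s \<Longrightarrow> char_moment v D j (\<lambda>_. 1) = 0"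
  shows "j + 2 * r = s \<Longrightarrow> L j r = L s 0"
    and "j + 2 * r = s + 2 \<Longrightarrow> L j r = L (s + 2) 0 - (\<Sum>l<r. a l) * L s 0"
proof -
  have step: "L j (Suc r) = L (j + 2) r - a r * L j r" for j r
    unfolding L_def char_moment_linear[symmetric]
    by (rule arg_cong[where f = "char_moment v D 0"])
      (simp add: fun_eq_iff algebra_simps power2_eq_square)
  have lt: "L j r = 0" if "j + 2 * r < s" for j r
    using that
  proof (induction r arbitrary: j)
    case 0
    then show ?case
      using char_moment_power_eq_0[OF assms(2), of s 0 j] by (simp add: L_def)
  next
    case (Suc r)
    then show ?case by (simp add: step)
  qed
  have eq: "L j r = L s 0" if "j + 2 * r = s" for j r
    using that
  proof (induction r arbitrary: j)
    case (Suc r)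
    then show ?case using lt[of j r] Suc.IH[of "j + 2"] by (simp add: step)
  qed simp
  have eq2: "L j r = L (s + 2) 0 - (\<Sum>l<r. a l) * L s 0" if "j + 2 * r = s + 2" for j r
    using that
  proof (induction r arbitrary: j)
    case (Suc r)
    then show ?case using eq[of j r] Suc.IH[of "j + 2"] by (simp add: step algebra_simps)
  qed simp
  show "j + 2 * r = s \<Longrightarrow> L j r = L s 0"
    and "j + 2 * r = s + 2 \<Longrightarrow> L j r = L (s + 2) 0 - (\<Sum>l<r. a l) * L s 0"
    using eq eq2 by blast+
qed

lemma sum_l_times_complement:
  assumes "m \<le> N"
  shows "6 * (\<Sum>l\<in>{0..m}. real l * real (N - l)) =
    real m * (real m + 1) * (3 * real N - (2 * real m + 1))"
  using assms
proof (induction m)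
  case (Suc m)
  then show ?case
    by (simp add: of_nat_diff algebra_simps)
qed simp

lemma sum_Suc_squares: "6 * (\<Sum>l<m. (real l + 1)\<^sup>2) = real m * (real m + 1) * (2 * real m + 1)"
  by (induction m) (simp_all add: algebra_simps power2_eq_square)

text \<open>
  Let \<open>z = n - 2 wt y\<close>, \<open>s = 4 k + 2\<close> and \<open>R(z) = \<Prod>\<^bsub>1 \<le> j \<le> 2k\<^esub> (z\<^sup>2 - 64 j\<^sup>2)\<close>. The
  product \<open>z R(z)\<close> vanishes at every word of \<open>D\<close> other than 0 and the all-one vector, where \<open>z\<close> is
  \<open>n\<close> and \<open>-n\<close>. So the twisted sum of \<open>z\<^sup>4 R(z)\<close> is \<open>n\<^sup>2\<close> times that of \<open>z\<^sup>2 R(z)\<close>.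
  The latter has degree \<open>s\<close> and is a multiple of \<open>B\<^sub>s\<close>; the former has degree \<open>s + 2\<close> and is a
  combination of \<open>B\<^sub>s\<close> and \<open>B\<^bsub>s+2\<^esub>\<close>. Comparing the two gives
  \<open>(s + 1) (s + 2) B\<^bsub>s+2\<^esub> = (n\<^sup>2 + \<Sum>\<^sub>j 64 j\<^sup>2 - \<Sum>\<^sub>l l (n + 1 - l)) B\<^sub>s\<close>.
  The cubic terms in \<open>k\<close> of the bracket cancel, and a polynomial with positive coefficients remains.
\<close>

lemma deep_coset_weight_ratio:
  fixes D :: "(bit ^ 'n) set"
  assumes n: "CARD('n) = 24 * k + 8" and D: "doubly_even_self_dual D"
    and d: "\<And>x. x \<in> D \<Longrightarrow> x \<noteq> 0 \<Longrightarrow> 4 * k + 4 \<le> weight x"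
    and v: "even (weight v)" "\<And>x. v + x \<in> D \<Longrightarrow> 4 * k + 2 \<le> weight x"
  defines "B \<equiv> \<lambda>i. card {x. weight x = i \<and> v + x \<in> D}"
  shows "(4 * k + 3) * (4 * k + 4) * B (4 * k + 4) = 8 * (4 * k + 1) * (11 * k + 3) * B (4 * k + 2)"
proof -
  have sd: "self_dual D" and de: "\<And>x. x \<in> D \<Longrightarrow> weight x mod 4 = 0"
    using D by (simp_all add: doubly_even_self_dual_def)
  then have sub: "vec.subspace D" and dual: "dual D = D" by (simp_all add: self_dual_def)
  define s where "s = 4 * k + 2"
  define a where "a l = 64 * (real l + 1)\<^sup>2" for l
  define R where "R t = (\<Prod>l<2 * k. t\<^sup>2 - a l)" for t
  define N where "N = real CARD('n)"
  let ?z = "krawtchouk_one :: bit ^ 'n \<Rightarrow> real"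
  let ?G = "\<lambda>i. char_moment v D i (\<lambda>_. 1)"
  have G: "?G i = real (card D) * real (B i)" for i
    unfolding B_def char_moment_const[OF sub] dual ..
  have G0: "?G i = 0" if "i < s" for i
  proof -
    have "{x. weight x = i \<and> v + x \<in> D} = {}"
      using v(2) that unfolding s_def by force
    then show ?thesis unfolding G B_def by (simp only: card.empty of_nat_0 mult_zero_right)
  qed
  have root: "?z y * R (?z y) = 0" if y: "y \<in> D" "y \<noteq> 0" "y \<noteq> 1" for y
  proof -
    have "1 + y \<in> D"
      using one_mem_self_dual[OF sd] y(1) sub by (simp add: subspace_bit_iff)
    then have "4 * k + 4 \<le> weight (1 + y)"
      using y(3) by (intro d) (simp_all add: vector_add_eq_0_iff)
    then have le: "weight y \<le> 20 * k + 4"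
      using weight_complement[of y] n by simp
    have "4 dvd weight y" using de[OF y(1)] by auto
    then obtain q where q: "weight y = 4 * q" by (rule dvdE)
    have q2: "k + 1 \<le> q" "q \<le> 5 * k + 1" using d[OF y(1,2)] le q by simp_all
    have z: "?z y = 8 * (3 * real k + 1 - real q)"
      unfolding krawtchouk_one_def n q by simp
    show ?thesis
    proof (cases "q = 3 * k + 1")
      case True
      then show ?thesis by (simp add: z)
    next
      case False
      \<comment> \<open>\<open>a l = (8 (l + 1))\<^sup>2\<close> is the square of the value of \<open>z\<close> at weight \<open>4 q\<close>.\<close>
      define l where "l = (if q < 3 * k + 1 then 3 * k - q else q - (3 * k + 2))"
      have "real l + 1 = 3 * real k + 1 - real q \<or> real l + 1 = - (3 * real k + 1 - real q)"
        using False by (auto simp: l_def of_nat_diff)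
      then have "(3 * real k + 1 - real q)\<^sup>2 = (real l + 1)\<^sup>2"
        by (metis power2_minus)
      moreover have "l < 2 * k"
        using q2 False by (auto simp: l_def)
      ultimately have "l < 2 * k" "(3 * real k + 1 - real q)\<^sup>2 = (real l + 1)\<^sup>2"
        by simp_all
      then have "(?z y)\<^sup>2 - a l = 0" "l < 2 * k"
        by (simp_all only: z a_def power_mult_distrib) simp_all
      then show ?thesis
        unfolding R_def by (metis finite_lessThan lessThan_iff mult_zero_right prod_zero)
    qed
  qed
  have N0: "N \<noteq> 0" unfolding N_def n by simp
  have z01: "?z 0 = N" "?z 1 = - N"
    by (simp_all add: krawtchouk_one_def N_def)
  have two: "char_moment v D 0 (\<lambda>y. ?z y ^ (2 * m + 2) * R (?z y)) = 2 * N ^ (2 * m + 2) * R N" for m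
  proof -
    have "(\<Sum>y\<in>D. chi v y * (?z y ^ (2 * m + 2) * R (?z y))) =
        (\<Sum>y\<in>{0, 1}. chi v y * (?z y ^ (2 * m + 2) * R (?z y)))"
    proof (rule sum.mono_neutral_right)
      show "{0, 1} \<subseteq> D"
        using one_mem_self_dual[OF sd] sub by (simp add: subspace_bit_iff)
      show "\<forall>y\<in>D - {0, 1}. chi v y * (?z y ^ (2 * m + 2) * R (?z y)) = 0"
        using root by auto
    qed simp
    moreover have "chi v 1 = 1"
      using v(1) scalar_product_one_eq_0_iff[of v] by (simp add: chi_def scalar_product_commute)
    moreover have "R (- N) = R N" by (simp add: R_def)
    moreover have "(0 :: bit ^ 'n) \<noteq> 1"
      by (metis weight_one weight_zero zero_neq_one n add_is_0 numeral_eq_Suc nat.distinct(1))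
    ultimately show ?thesis
      by (simp add: char_moment_0 z01)
  qed
  have "char_moment v D 0 (\<lambda>y. ?z y ^ 4 * R (?z y)) = N\<^sup>2 * char_moment v D 0 (\<lambda>y. ?z y ^ 2 * R (?z y))"
    using two[of 0] two[of 1] by (simp add: power2_eq_square numeral_eq_Suc)
  moreover have "char_moment v D 0 (\<lambda>y. ?z y ^ 2 * R (?z y)) = char_moment v D 0 (\<lambda>y. ?z y ^ s)"
    using char_moment_even_product(1)[OF G0, of s 2 "2 * k" a] by (simp add: R_def s_def)
  moreover have "char_moment v D 0 (\<lambda>y. ?z y ^ 4 * R (?z y)) =
      char_moment v D 0 (\<lambda>y. ?z y ^ (s + 2)) - (\<Sum>l<2 * k. a l) * char_moment v D 0 (\<lambda>y. ?z y ^ s)"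
    using char_moment_even_product(2)[OF G0, of s 4 "2 * k" a] by (simp add: R_def s_def)
  moreover have "char_moment v D 0 (\<lambda>y. ?z y ^ s) = fact s * ?G s"
    using char_moment_power_leading[OF G0, of s 0 s] by simp
  moreover have "char_moment v D 0 (\<lambda>y. ?z y ^ (s + 2)) = fact (s + 2) * ?G (s + 2) +
      (\<Sum>l\<in>{0..s + 1}. real l * real (CARD('n) + 1 - l)) * (fact s * ?G s)"
    using char_moment_power_second[OF G0, of s 0 "s + 2"] by simp
  ultimately have "fact (s + 2) * ?G (s + 2) =
      (N\<^sup>2 + (\<Sum>l<2 * k. a l) - (\<Sum>l\<in>{0..s + 1}. real l * real (CARD('n) + 1 - l))) * (fact s * ?G s)"
    by (simp add: algebra_simps)
  moreover have "fact (s + 2) = (real s + 1) * (real s + 2) * fact s"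
    by (simp add: algebra_simps)
  moreover have "N\<^sup>2 + (\<Sum>l<2 * k. a l) - (\<Sum>l\<in>{0..s + 1}. real l * real (CARD('n) + 1 - l)) =
      real (8 * (4 * k + 1) * (11 * k + 3))"
  proof -
    have "6 * (\<Sum>l\<in>{0..s + 1}. real l * real (CARD('n) + 1 - l)) =
        real (s + 1) * (real (s + 1) + 1) * (3 * real (CARD('n) + 1) - (2 * real (s + 1) + 1))"
      by (rule sum_l_times_complement) (simp add: n s_def)
    moreover have "6 * (\<Sum>l<2 * k. a l) = 64 * (real (2 * k) * (real (2 * k) + 1) * (2 * real (2 * k) + 1))"
      unfolding sum_Suc_squares[symmetric] a_def sum_distrib_left[symmetric] by simp
    ultimately have "6 * (N\<^sup>2 + (\<Sum>l<2 * k. a l) - (\<Sum>l\<in>{0..s + 1}. real l * real (CARD('n) + 1 - l))) =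
        6 * real (8 * (4 * k + 1) * (11 * k + 3))"
      unfolding N_def n s_def by (simp add: algebra_simps power2_eq_square)
    then show ?thesis by simp
  qed
  ultimately have "fact s * real (card D) * ((real s + 1) * (real s + 2) * real (B (s + 2))) =
      fact s * real (card D) * (real (8 * (4 * k + 1) * (11 * k + 3)) * real (B s))"
    unfolding G by (simp only: mult_ac)
  moreover have "card D \<noteq> 0"
    using sub by (auto simp: subspace_bit_iff)
  ultimately have "(real s + 1) * (real s + 2) * real (B (s + 2)) = real (8 * (4 * k + 1) * (11 * k + 3)) * real (B s)"
    by simp
  then have "real ((s + 1) * (s + 2) * B (s + 2)) = real (8 * (4 * k + 1) * (11 * k + 3) * B s)"
    by (simp only: of_nat_mult of_nat_add of_nat_1 of_nat_numeral)
  moreover have "s + 1 = 4 * k + 3" "s + 2 = 4 * k + 4"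
    by (simp_all add: s_def)
  ultimately show ?thesis
    by (simp only: of_nat_eq_iff s_def)
qed

section \<open>The correspondence\<close>

text \<open>
  A word \<open>t\<close> of weight \<open>4 k + 2\<close> in \<open>C\<close> is outside \<open>C\<^sub>0\<close>, so its coset \<open>t + D\<close> splits into the
  other half of \<open>C\<close> and the other shadow coset, neither of which has weights below \<open>4 k + 2\<close>.
\<close>

lemma s_extremal_neighbor_extremal:
  fixes C :: "(bit ^ 'n) set"
  assumes n: "CARD('n) = 24 * k + 8" and C: "singly_even_self_dual C"
    and dC: "min_weight C = 4 * k + 2" and dS: "min_weight (shadow C) = 4 * k + 4"
    and u: "u \<in> shadow C"
  defines "D \<equiv> doubly_even_subcode C \<union> (+) u ` doubly_even_subcode C"
  shows "extremal D" "min_weight D = 4 * k + 4" "covering_radius D = 4 * k + 2" "delsarte_bound D = 4 * k + 2"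
proof -
  let ?C0 = "doubly_even_subcode C"
  have sd: "self_dual C" using C by (simp add: singly_even_self_dual_def)
  have sub: "vec.subspace C" using sd by (simp add: self_dual_def)
  have "8 dvd CARD('n)" unfolding n by presburger
  then have D: "doubly_even_self_dual D"
    unfolding D_def by (rule doubly_even_neighbor(1)[OF C _ u])
  have coset: "(+) u ` ?C0 \<subseteq> shadow C" by (rule translate_subcode_subset_shadow[OF sd u])
  have S: "4 * k + 4 \<le> weight x" if "x \<in> shadow C" for x
  proof -
    have "x \<noteq> 0" using that sub by (auto simp: shadow_def subspace_bit_iff)
    then show ?thesis using min_weight_le[OF that] dS by simp
  qed
  have d: "4 * k + 4 \<le> weight x" if "x \<in> D" "x \<noteq> 0" for x
  proof (cases "x \<in> ?C0")
    case True
    then have "4 * k + 2 \<le> weight x" "weight x mod 4 = 0"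
      using min_weight_le[of x C] dC \<open>x \<noteq> 0\<close> by (auto simp: doubly_even_subcode_def)
    then show ?thesis by presburger
  next
    case False
    then show ?thesis using S coset that unfolding D_def by blast
  qed
  obtain w where "w \<in> C" "weight w mod 4 = 2"
    using C by (auto simp: singly_even_self_dual_def)
  then have "w \<in> C - {0}" by auto
  then have "C - {0} \<noteq> {}" by blast
  then obtain t where t: "t \<in> C" "t \<noteq> 0" "weight t = 4 * k + 2"
    using min_weight_attained[of C] dC by metis
  then have "weight t mod 4 = 2" by presburger
  \<comment> \<open>Elements of \<open>t + D\<close> in \<open>C\<close> are non-zero, the others are in the shadow.\<close>
  have deep: "4 * k + 2 \<le> weight x" if "t + x \<in> D" for x
  proof (cases "x \<in> C")
    case True
    then have "t + x \<in> C" using t(1) sub by (simp add: subspace_bit_iff)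
    then have "t + x \<in> ?C0"
      using that coset unfolding D_def shadow_def by blast
    then have "x \<noteq> 0"
      using \<open>weight t mod 4 = 2\<close> by (auto simp: doubly_even_subcode_def)
    then show ?thesis using min_weight_le[OF True] dC by simp
  next
    case False
    have "t \<in> dual ?C0" using self_dual_subset_dual_subcode[OF sd] t(1) by blast
    moreover have "?C0 \<subseteq> dual ?C0"
      using self_dual_subset_dual_subcode[OF sd] by (auto simp: doubly_even_subcode_def)
    then have "t + x \<in> dual ?C0"
      using that coset unfolding D_def shadow_def by blast
    ultimately have "x \<in> dual ?C0"
      using subspace_add_mem_iff[OF subspace_dual, of t ?C0 x] by (simp add: add.commute)
    then have "x \<in> shadow C" using False by (simp add: shadow_def)
    then show ?thesis using S[of x] by simp
  qed
  show "covering_radius D = 4 * k + 2" "delsarte_bound D = 4 * k + 2" and mw: "min_weight D = 4 * k + 4"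
    using extremal_of_deep_coset[OF n D d deep] by blast+
  have "CARD('n) mod 24 = 8" "CARD('n) div 24 = k" unfolding n by simp_all
  then show "extremal D"
    using D mw by (simp add: extremal_def doubly_even_self_dual_def)
qed

text \<open>
  Replacing the words of \<open>D\<close> not orthogonal to \<open>v\<close> by the coset \<open>v + D\<^sub>0\<close> gives \<open>C\<close>. The dual of
  \<open>D\<^sub>0\<close> is \<open>D \<union> (v + D)\<close>; within \<open>v + D\<close> the weight modulo 4 is 2 on the part in \<open>C\<close> and 0 on
  the part in the shadow. Therefore the vector of weight \<open>4 k + 4\<close> supplied by
  \<open>deep_coset_weight_ratio\<close> lies in the shadow.
\<close>

lemma deep_coset_neighbor_s_extremal:
  fixes D :: "(bit ^ 'n) set"
  assumes n: "CARD('n) = 24 * k + 8" and D: "doubly_even_self_dual D"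
    and d: "\<And>x. x \<in> D \<Longrightarrow> x \<noteq> 0 \<Longrightarrow> 4 * k + 4 \<le> weight x"
    and wv: "weight v = 4 * k + 2" and v: "\<And>x. v + x \<in> D \<Longrightarrow> 4 * k + 2 \<le> weight x"
  defines "D0 \<equiv> {u \<in> D. scalar_product v u = 0}"
  defines "C \<equiv> D0 \<union> (+) v ` D0"
  shows "neighbors D C" "singly_even_self_dual C" "min_weight C = 4 * k + 2" "min_weight (shadow C) = 4 * k + 4"
proof -
  have sd: "self_dual D" and de: "\<And>x. x \<in> D \<Longrightarrow> weight x mod 4 = 0"
    using D by (simp_all add: doubly_even_self_dual_def)
  then have sub: "vec.subspace D" and dual: "dual D = D" by (simp_all add: self_dual_def)
  have vD: "v \<notin> D" using v[of 0] by auto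
  have vv: "scalar_product v v = 0"
    unfolding scalar_product_self_eq_0_iff wv by simp
  have "D0 \<subseteq> D" by (auto simp: D0_def)
  have sub0: "vec.subspace D0"
    using sub by (auto simp: D0_def subspace_bit_iff scalar_product_add_right)
  have card0: "2 * card D0 = card D"
    unfolding D0_def by (rule card_orthogonal_half[OF sub]) (simp add: dual vD)
  have subC: "vec.subspace C" unfolding C_def by (rule subspace_Un_translate[OF sub0])
  have cardC: "card C = card D"
    unfolding C_def using card_Un_translate[OF sub0] vD \<open>D0 \<subseteq> D\<close> card0 by auto
  have memC: "x \<in> C \<longleftrightarrow> x \<in> D0 \<or> v + x \<in> D0" for x
    by (simp add: C_def mem_translate_iff)
  have orth0: "scalar_product x y = 0" if "x \<in> D0" "y \<in> C" for x y
  proof -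
    have *: "scalar_product x z = 0" if "z \<in> D" for z
      using self_dual_scalar_product[OF sd _ that] \<open>x \<in> D0\<close> by (auto simp: D0_def)
    have xv: "scalar_product x v = 0"
      using \<open>x \<in> D0\<close> by (simp add: D0_def scalar_product_commute)
    consider "y \<in> D" | "v + y \<in> D" using \<open>y \<in> C\<close> \<open>D0 \<subseteq> D\<close> memC by blast
    then show ?thesis
    proof cases
      case 2
      then have "scalar_product x (v + y) = 0" by (rule *)
      then show ?thesis by (simp only: scalar_product_add_right xv add_0_left)
    qed (rule *)
  qed
  have orth: "scalar_product x y = 0" if "x \<in> C" "y \<in> C" for x y
  proof -
    have vy: "scalar_product v y = 0"
    proof -
      consider "y \<in> D0" | "v + y \<in> D0" using \<open>y \<in> C\<close> memC by blast
      then show ?thesis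
      proof cases
        case 2
        then have "scalar_product v (v + y) = 0" by (simp only: D0_def mem_Collect_eq)
        then show ?thesis by (simp only: scalar_product_add_right vv add_0_left)
      qed (simp add: D0_def)
    qed
    consider "x \<in> D0" | "v + x \<in> D0" using \<open>x \<in> C\<close> memC by blast
    then show ?thesis
    proof cases
      case 1
      then show ?thesis using orth0 \<open>y \<in> C\<close> by blast
    next
      case 2
      then have "scalar_product (v + x) y = 0" using orth0 \<open>y \<in> C\<close> by blast
      then show ?thesis by (simp only: scalar_product_add_left vy add_0_left)
    qed
  qed
  have sdC: "self_dual C"
    using self_dualI[OF subC] orth cardC self_dual_card[OF sd] by (auto simp: dual_def)
  have "D \<inter> C = D0"
    using \<open>D0 \<subseteq> D\<close> vD subspace_add_mem_iff[OF sub] by (auto simp: memC)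
  then show "neighbors D C"
    using card0 by (simp add: neighbors_iff_card[OF sd sdC])
  have vC: "v \<in> C" using sub0 by (simp add: memC subspace_bit_iff)
  have mod4: "(4 * k + 2 + m) mod 4 = 2" if "m mod 4 = 0" for m :: nat
    using that by presburger
  have mod2: "weight x mod 4 = 2" if "v + x \<in> D0" for x
  proof -
    have "scalar_product v (v + x) = 0" "weight (v + x) mod 4 = 0"
      using that de by (simp_all only: D0_def mem_Collect_eq)
    then have "weight x mod 4 = (4 * k + 2 + weight (v + x)) mod 4"
      using weight_add_mod_4_orthogonal[of v "v + x"] wv by simp
    then show ?thesis
      unfolding mod4[OF \<open>weight (v + x) mod 4 = 0\<close>] .
  qed
  have mod0: "weight x mod 4 = 0" if "v + x \<in> D - D0" for x
  proof -
    have "scalar_product v (v + x) \<noteq> 0" "weight (v + x) mod 4 = 0"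
      using that de by (auto simp only: D0_def mem_Collect_eq Diff_iff)
    then have "(weight x + 2) mod 4 = (4 * k + 2 + weight (v + x)) mod 4"
      using weight_add_mod_4_not_orthogonal[of v "v + x"] wv by simp
    then have "(weight x + 2) mod 4 = 2"
      unfolding mod4[OF \<open>weight (v + x) mod 4 = 0\<close>] .
    then show ?thesis by presburger
  qed
  have "weight v mod 4 = 2" unfolding wv by presburger
  then show seC: "singly_even_self_dual C"
    using sdC vC by (auto simp: singly_even_self_dual_def)
  have v0: "v \<noteq> 0" using vD sub by (auto simp: subspace_bit_iff)
  show "min_weight C = 4 * k + 2"
  proof (rule min_weight_eqI[OF vC v0 wv])
    fix y assume "y \<in> C" "y \<noteq> 0"
    then show "4 * k + 2 \<le> weight y"
      using d[of y] v[of y] \<open>D0 \<subseteq> D\<close> by (auto simp: memC)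
  qed
  have C0: "doubly_even_subcode C = D0"
  proof (intro set_eqI iffI)
    fix x assume "x \<in> doubly_even_subcode C"
    then show "x \<in> D0" using mod2[of x] by (auto simp: doubly_even_subcode_def memC)
  next
    fix x assume "x \<in> D0"
    then show "x \<in> doubly_even_subcode C"
      using de \<open>D0 \<subseteq> D\<close> by (auto simp: doubly_even_subcode_def memC)
  qed
  have dual0: "dual D0 = D \<union> (+) v ` D"
  proof -
    have "D \<subseteq> dual D0" using dual_antimono[OF \<open>D0 \<subseteq> D\<close>] dual by simp
    moreover have "v \<in> dual D0" by (simp add: dual_def D0_def)
    ultimately have "D \<union> (+) v ` D \<subseteq> dual D0"
      using subspace_dual[of D0] by (auto simp: subspace_bit_iff)
    moreover have "card (dual D0) = card (D \<union> (+) v ` D)"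
    proof -
      have "card (dual D0) * card D0 = (2 * card D) * card D0"
        using card_dual[OF sub0] self_dual_card[OF sd] card0 by (metis mult.assoc mult.commute)
      moreover have "card D0 \<noteq> 0"
        using sub0 by (auto simp: subspace_bit_iff)
      ultimately have "card (dual D0) = 2 * card D"
        by (metis mult_right_cancel)
      then show ?thesis using card_Un_translate[OF sub vD] by simp
    qed
    ultimately show ?thesis by (metis card_subset_eq finite)
  qed
  define B where "B i = card {x. weight x = i \<and> v + x \<in> D}" for i
  have B: "(4 * k + 3) * (4 * k + 4) * B (4 * k + 4) = 8 * (4 * k + 1) * (11 * k + 3) * B (4 * k + 2)"
    unfolding B_def by (rule deep_coset_weight_ratio[OF n D d _ v]) (simp_all add: wv)
  have "v \<in> {x. weight x = 4 * k + 2 \<and> v + x \<in> D}"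
    using wv sub by (simp add: subspace_bit_iff)
  then have "{x. weight x = 4 * k + 2 \<and> v + x \<in> D} \<noteq> {}"
    by blast
  then have "B (4 * k + 2) \<noteq> 0"
    by (simp only: B_def card_0_eq[OF finite] not_False_eq_True)
  then have "B (4 * k + 4) \<noteq> 0"
    using B by (intro notI) simp
  then have "{x. weight x = 4 * k + 4 \<and> v + x \<in> D} \<noteq> {}"
    by (simp only: B_def card_0_eq[OF finite] not_False_eq_True)
  then obtain w where w: "weight w = 4 * k + 4" "v + w \<in> D"
    by blast
  have wC: "w \<notin> C"
  proof
    assume "w \<in> C"
    moreover have "w \<notin> D" using w(2) vD subspace_add_mem_iff[OF sub] by blast
    ultimately have "weight w mod 4 = 2" using mod2 memC \<open>D0 \<subseteq> D\<close> by blast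
    then show False unfolding w(1) by presburger
  qed
  show "min_weight (shadow C) = 4 * k + 4"
  proof (rule min_weight_eqI[of w])
    show "w \<in> shadow C"
      using wC w(2) by (simp add: shadow_def C0 dual0 mem_translate_iff)
    show "w \<noteq> 0" using w(1) by auto
    show "weight w = 4 * k + 4" by (rule w(1))
    fix y assume "y \<in> shadow C" "y \<noteq> 0"
    then have y: "y \<in> D \<or> v + y \<in> D - D0"
      by (auto simp: shadow_def C0 dual0 mem_translate_iff memC)
    then show "4 * k + 4 \<le> weight y"
    proof
      assume "v + y \<in> D - D0"
      then have "4 * k + 2 \<le> weight y" "weight y mod 4 = 0"
        using v[of y] mod0[of y] by simp_all
      then show ?thesis by presburger
    qed (use d[of y] \<open>y \<noteq> 0\<close> in simp)
  qed
qed

theorem theorem1: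
  fixes k :: nat
  shows
    "(\<forall>C C0 C1 C2 C3 :: (bit ^ 'n) set.
        is_code (24 * k + 8) (12 * k + 4) (4 * k + 2) C \<longrightarrow>
        singly_even_self_dual C \<longrightarrow>
        s_extremal C \<longrightarrow>
        coset_decomposition C C0 C1 C2 C3 \<longrightarrow>
        C0 \<union> C1 \<noteq> C0 \<union> C3 \<and>
        {D. doubly_even_self_dual D \<and> neighbors C D} = {C0 \<union> C1, C0 \<union> C3} \<and>
        (\<forall>D \<in> {C0 \<union> C1, C0 \<union> C3}.
           extremal D \<and> min_weight D = 4 * k + 4 \<and>
           covering_radius D = 4 * k + 2 \<and> covering_radius D = delsarte_bound D)) \<and>
     (\<forall>D :: (bit ^ 'n) set.
        is_code (24 * k + 8) (12 * k + 4) (4 * k + 4) D \<longrightarrow>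
        doubly_even_self_dual D \<longrightarrow>
        extremal D \<longrightarrow>
        covering_radius D = 4 * k + 2 \<longrightarrow>
        (\<exists>C. neighbors D C \<and>
             is_code (24 * k + 8) (12 * k + 4) (4 * k + 2) C \<and>
             singly_even_self_dual C \<and>
             s_extremal C))"
proof (intro conjI allI impI)
  fix C C0 C1 C2 C3 :: "(bit ^ 'n) set"
  assume code: "is_code (24 * k + 8) (12 * k + 4) (4 * k + 2) C"
    and C: "singly_even_self_dual C" and sx: "s_extremal C"
    and dec: "coset_decomposition C C0 C1 C2 C3"
  have n: "CARD('n) = 24 * k + 8" and dC: "min_weight C = 4 * k + 2"
    using code by (simp_all add: is_code_def)
  have "real (min_weight (shadow C)) = real (4 * k + 4)"
    using sx by (simp add: s_extremal_def n dC)
  then have dS: "min_weight (shadow C) = 4 * k + 4" by (simp only: of_nat_eq_iff)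
  have C0: "C0 = doubly_even_subcode C" and S: "shadow C = C1 \<union> C3"
    and disj: "C0 \<inter> C1 = {}" "C0 \<inter> C3 = {}" "C1 \<inter> C3 = {}"
    using dec unfolding coset_decomposition_def by blast+
  have sub: "vec.subspace C0"
    using C subspace_doubly_even_subcode unfolding C0 singly_even_self_dual_def by blast
  have coset: "A = (+) u ` C0" if u: "u \<in> A" and A: "A = C1 \<or> A = C3" for u A
  proof -
    obtain w where "A = (+) w ` C0"
      using dec A unfolding coset_decomposition_def is_coset_def by blast
    then show ?thesis using translate_mem_eq[OF sub] u by blast
  qed
  have "\<exists>u. u \<in> A" if "A = C1 \<or> A = C3" for A
    using dec that sub unfolding coset_decomposition_def is_coset_def subspace_bit_iff by blast
  then obtain u1 u3 where u: "u1 \<in> C1" "u3 \<in> C3" by blast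
  show "C0 \<union> C1 \<noteq> C0 \<union> C3" using u disj by blast
  have eq: "(\<lambda>u. C0 \<union> (+) u ` C0) ` shadow C = {C0 \<union> C1, C0 \<union> C3}"
  proof (intro equalityI subsetI)
    fix D assume "D \<in> (\<lambda>u. C0 \<union> (+) u ` C0) ` shadow C"
    then show "D \<in> {C0 \<union> C1, C0 \<union> C3}"
      using coset unfolding S by blast
  next
    fix D assume "D \<in> {C0 \<union> C1, C0 \<union> C3}"
    then have "D = C0 \<union> (+) u1 ` C0 \<or> D = C0 \<union> (+) u3 ` C0"
      using coset[OF u(1)] coset[OF u(2)] by blast
    then show "D \<in> (\<lambda>u. C0 \<union> (+) u ` C0) ` shadow C"
      using u unfolding S by blast
  qed
  have "8 dvd CARD('n)" unfolding n by presburger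
  then show "{D. doubly_even_self_dual D \<and> neighbors C D} = {C0 \<union> C1, C0 \<union> C3}"
    using doubly_even_neighbors_eq[OF C] eq unfolding C0 by simp
  show "\<forall>D \<in> {C0 \<union> C1, C0 \<union> C3}.
      extremal D \<and> min_weight D = 4 * k + 4 \<and>
      covering_radius D = 4 * k + 2 \<and> covering_radius D = delsarte_bound D"
    unfolding eq[symmetric] unfolding C0 using s_extremal_neighbor_extremal[OF n C dC dS] by auto
next
  fix D :: "(bit ^ 'n) set"
  assume code: "is_code (24 * k + 8) (12 * k + 4) (4 * k + 4) D" and D: "doubly_even_self_dual D"
    and R: "covering_radius D = 4 * k + 2"
  have n: "CARD('n) = 24 * k + 8" and dD: "min_weight D = 4 * k + 4" and sub: "vec.subspace D"
    using code by (simp_all add: is_code_def)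
  have d: "4 * k + 4 \<le> weight x" if "x \<in> D" "x \<noteq> 0" for x
    using min_weight_le[OF that] dD by simp
  obtain v where v: "weight v = 4 * k + 2" "\<And>x. v + x \<in> D \<Longrightarrow> 4 * k + 2 \<le> weight x"
    using deep_hole_leader[OF sub] unfolding R by blast
  define C where "C = {u \<in> D. scalar_product v u = 0} \<union> (+) v ` {u \<in> D. scalar_product v u = 0}"
  have nb: "neighbors D C" "singly_even_self_dual C"
    and dC: "min_weight C = 4 * k + 2" and dS: "min_weight (shadow C) = 4 * k + 4"
    unfolding C_def by (rule deep_coset_neighbor_s_extremal[OF n D d v]; assumption)+
  have sd: "self_dual C" using nb(2) by (simp add: singly_even_self_dual_def)
  then have "is_code (24 * k + 8) (12 * k + 4) (4 * k + 2) C"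
    using dC self_dual_dim[OF sd] n by (simp add: is_code_def self_dual_def)
  moreover have "s_extremal C"
  proof -
    have "CARD('n) mod 24 \<noteq> 22" unfolding n by simp
    moreover have "real (min_weight (shadow C)) = real CARD('n) / 2 + 4 - 2 * real (min_weight C)"
      unfolding dC dS n by simp
    ultimately show ?thesis using nb(2) by (simp add: s_extremal_def)
  qed
  ultimately show "\<exists>C. neighbors D C \<and> is_code (24 * k + 8) (12 * k + 4) (4 * k + 2) C \<and>
      singly_even_self_dual C \<and> s_extremal C"
    using nb by blast
qed

end
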